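(* Let $\Omega\subset\mathbb{S}^2_1$ be a domain and let $u\in C^2(\Omega)$ satisfy $$\Box_{\mathbb{S}^2_1}u+2u=0.$$ Then, on the regular set $$\Omega_{\rm reg}=\{p\in\Omega:\det(\operatorname{Hess}u+u\operatorname{Id})\neq0\},$$ the map $X_u(p)=u(p)\,p+\nabla u(p)$ is a timelike minimal immersion in $\mathbb{L}^3$ and its spacelike Gauss map is the inclusion $\Omega_{\rm reg}\hookrightarrow\mathbb{S}^2_1$. Conversely, let $X$ be a timelike minimal surface in $\mathbb{L}^3$ whose Gauss map is locally invertible away from its branch points. Then its inverse Gauss parametrization is locally of the form $X(p)=u(p)\,p+\nabla u(p)$, where $u(p)=\langle X(p),p\rangle$ is the support function, and $u$ satisfies $\Box_{\mathbb{S}^2_1}u+2u=0$.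
   Context: $\mathbb{L}^3=(\mathbb{R}^3,\langle\,,\,\rangle)$ is Lorentz--Minkowski space of signature $(+,+,-)$, and the de Sitter plane is $\mathbb{S}^2_1=\{p\in\mathbb{L}^3:\langle p,p\rangle=1\}$ with the induced Lorentzian metric. $\nabla u$ is the intrinsic gradient, regarded as a vector in $T_p\mathbb{S}^2_1=p^\perp\subset\mathbb{L}^3$; $\operatorname{Hess}u(Y)=\nabla_Y\nabla u$; $\Box_{\mathbb{S}^2_1}$ is the metric trace of the Hessian. A timelike immersion is one whose induced metric is Lorentzian; it is minimal if its mean curvature vanishes. The Gauss map of a timelike surface is its spacelike unit normal, with values in $\mathbb{S}^2_1$ (determined up to orientation). Locally invertible means local diffeomorphism; away from its branch points (where the surface fails to be immersed), the surface can be locally parametrized by its Gauss map $p\in\mathbb{S}^2_1$, and this is its inverse Gauss parametrization. *)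

theory Defs
  imports "HOL-Analysis.Analysis"
begin

section \<open>Maps of class C1 and C2\<close>

text \<open>\<open>C1_on\<close> and \<open>C2_on\<close> are meant for open sets. On an arbitrary subset of a Euclidean space, such
  as a relatively open subset of the de Sitter plane, a map is of class C1 (C2) if near each point of
  the subset it extends to a C1 (C2) map on an open set of the ambient space.\<close>

definition C1_on :: "('a::real_normed_vector \<Rightarrow> 'b::real_normed_vector) \<Rightarrow> 'a set \<Rightarrow> bool" where
  "C1_on f S \<longleftrightarrow>
     (\<exists>f'. (\<forall>x\<in>S. (f has_derivative blinfun_apply (f' x)) (at x)) \<and> continuous_on S f')"

definition C2_on :: "('a::real_normed_vector \<Rightarrow> 'b::real_normed_vector) \<Rightarrow> 'a set \<Rightarrow> bool" where
  "C2_on f S \<longleftrightarrow>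
     (\<exists>f'. (\<forall>x\<in>S. (f has_derivative blinfun_apply (f' x)) (at x)) \<and> C1_on f' S)"

definition C1_subset :: "('a::real_normed_vector \<Rightarrow> 'b::real_normed_vector) \<Rightarrow> 'a set \<Rightarrow> bool" where
  "C1_subset f S \<longleftrightarrow> (\<forall>p\<in>S. \<exists>V g. open V \<and> p \<in> V \<and> C1_on g V \<and> (\<forall>x\<in>V \<inter> S. g x = f x))"

definition C2_subset :: "('a::real_normed_vector \<Rightarrow> 'b::real_normed_vector) \<Rightarrow> 'a set \<Rightarrow> bool" where
  "C2_subset f S \<longleftrightarrow> (\<forall>p\<in>S. \<exists>V g. open V \<and> p \<in> V \<and> C2_on g V \<and> (\<forall>x\<in>V \<inter> S. g x = f x))"


section \<open>Lorentz--Minkowski space and the de Sitter plane\<close>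

definition mink :: "real^3 \<Rightarrow> real^3 \<Rightarrow> real" where
  "mink x y = x $ 1 * y $ 1 + x $ 2 * y $ 2 - x $ 3 * y $ 3"

definition dS :: "(real^3) set" where
  "dS = {p. mink p p = 1}"

definition tangent :: "real^3 \<Rightarrow> (real^3) set" where
  "tangent p = {v. mink p v = 0}"

text \<open>A derivative at \<open>p\<close> within \<open>dS\<close> is uniquely determined on \<open>tangent p\<close>, where it is the
  differential on the surface, and is arbitrary on complements of \<open>tangent p\<close>. So the gradient is
  the unique tangent vector that represents the differential of \<open>u\<close> with respect to the metric.
  Only the germ of \<open>u\<close> at \<open>p\<close> in \<open>dS\<close> matters, so no domain has to be mentioned.\<close>

definition grad :: "(real^3 \<Rightarrow> real) \<Rightarrow> real^3 \<Rightarrow> real^3" where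
  "grad u p = (THE v. v \<in> tangent p \<and> (u has_derivative mink v) (at p within dS))"

text \<open>The Levi-Civita connection of \<open>dS\<close>: the tangential part of the derivative of the vector field
  \<open>Z\<close> along the tangent vector \<open>Y\<close>; note that \<open>p\<close> is a unit normal of \<open>dS\<close> at \<open>p\<close>. It is used for
  \<open>Y \<in> tangent p\<close> only.\<close>

definition covariant_deriv :: "(real^3 \<Rightarrow> real^3) \<Rightarrow> real^3 \<Rightarrow> real^3 \<Rightarrow> real^3" where
  "covariant_deriv Z p Y =
     (let D = frechet_derivative Z (at p within dS) Y in D - mink D p *\<^sub>R p)"

definition hess :: "(real^3 \<Rightarrow> real) \<Rightarrow> real^3 \<Rightarrow> real^3 \<Rightarrow> real^3" where
  "hess u p Y = covariant_deriv (grad u) p Y"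

text \<open>The metric trace and the determinant of an endomorphism \<open>A\<close> of \<open>tangent p\<close>, as the common
  value over all orthonormal frames and over all bases, respectively.\<close>

definition metric_trace :: "real^3 \<Rightarrow> (real^3 \<Rightarrow> real^3) \<Rightarrow> real" where
  "metric_trace p A = (THE t. \<forall>e1\<in>tangent p. \<forall>e2\<in>tangent p.
     mink e1 e1 = 1 \<and> mink e2 e2 = -1 \<and> mink e1 e2 = 0 \<longrightarrow> t = mink (A e1) e1 - mink (A e2) e2)"

definition tangent_det :: "real^3 \<Rightarrow> (real^3 \<Rightarrow> real^3) \<Rightarrow> real" where
  "tangent_det p A = (THE d. \<forall>b1\<in>tangent p. \<forall>b2\<in>tangent p. \<forall>M::real^2^2.
     b1 \<noteq> b2 \<and> independent {b1, b2} \<and>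
     A b1 = M $ 1 $ 1 *\<^sub>R b1 + M $ 2 $ 1 *\<^sub>R b2 \<and> A b2 = M $ 1 $ 2 *\<^sub>R b1 + M $ 2 $ 2 *\<^sub>R b2
     \<longrightarrow> d = det M)"

definition box_dS :: "(real^3 \<Rightarrow> real) \<Rightarrow> real^3 \<Rightarrow> real" where
  "box_dS u p = metric_trace p (hess u p)"

definition reg_set :: "(real^3) set \<Rightarrow> (real^3 \<Rightarrow> real) \<Rightarrow> (real^3) set" where
  "reg_set \<Omega> u = {p \<in> \<Omega>. tangent_det p (\<lambda>Y. hess u p Y + u p *\<^sub>R Y) \<noteq> 0}"

definition X_map :: "(real^3 \<Rightarrow> real) \<Rightarrow> real^3 \<Rightarrow> real^3" where
  "X_map u p = u p *\<^sub>R p + grad u p"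


section \<open>Surfaces\<close>

text \<open>An atlas is given by local parametrizations \<open>(W, x)\<close>, where \<open>x\<close> maps the open set \<open>W\<close> of the
  plane homeomorphically onto an open subset of the surface.\<close>

type_synonym 'm atlas = "((real^2) set \<times> (real^2 \<Rightarrow> 'm)) set"

definition C1_surface :: "'m topology \<Rightarrow> 'm atlas \<Rightarrow> bool" where
  "C1_surface T A \<longleftrightarrow>
     Hausdorff_space T \<and> second_countable T \<and>
     (\<forall>(W, x)\<in>A. open W \<and> openin T (x ` W) \<and>
        homeomorphic_map (top_of_set W) (subtopology T (x ` W)) x) \<and>
     topspace T = (\<Union>(W, x)\<in>A. x ` W) \<and>
     (\<forall>(W, x)\<in>A. \<forall>(W', x')\<in>A. C1_on (inv_into W' x' \<circ> x) (W \<inter> x -` (x' ` W')))"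

text \<open>The maximal C1 atlas of the de Sitter plane: all its regular C1 parametrizations.\<close>

definition dS_atlas :: "(real^3) atlas" where
  "dS_atlas = {(W, x). open W \<and> openin (top_of_set dS) (x ` W) \<and>
     homeomorphic_map (top_of_set W) (top_of_set (x ` W)) x \<and>
     C1_on x W \<and> (\<forall>w\<in>W. inj (frechet_derivative x (at w)))}"

text \<open>The following notions refer to a surface with atlas \<open>A\<close> and to an open subset \<open>U\<close> of it.\<close>

definition C1_map :: "'m atlas \<Rightarrow> 'm set \<Rightarrow> ('m \<Rightarrow> real^3) \<Rightarrow> bool" where
  "C1_map A U X \<longleftrightarrow> (\<forall>(W, x)\<in>A. C1_on (X \<circ> x) (W \<inter> x -` U))"

definition immersed_at :: "'m atlas \<Rightarrow> ('m \<Rightarrow> real^3) \<Rightarrow> 'm \<Rightarrow> bool" where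
  "immersed_at A X q \<longleftrightarrow>
     (\<forall>(W, x)\<in>A. \<forall>w\<in>W. x w = q \<longrightarrow> inj (frechet_derivative (X \<circ> x) (at w)))"

definition first_form :: "(real^2 \<Rightarrow> real^3) \<Rightarrow> real^2 \<Rightarrow> real^2^2" where
  "first_form Y w = (\<chi> i j. mink (frechet_derivative Y (at w) (axis i 1))
                               (frechet_derivative Y (at w) (axis j 1)))"

text \<open>The second fundamental form with respect to the unit normal field \<open>n\<close>, written with the
  derivative of \<open>n\<close> (Weingarten) so that it makes sense for a C1 immersion with C1 normal. This
  generality is needed: for \<open>u\<close> of class C2 the map \<open>X_map u\<close> need only be of class C1. The
  mean curvature is half the trace of the second form with respect to the first.\<close>

definition second_form :: "(real^2 \<Rightarrow> real^3) \<Rightarrow> (real^2 \<Rightarrow> real^3) \<Rightarrow> real^2 \<Rightarrow> real^2^2" where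
  "second_form Y n w = (\<chi> i j. - mink (frechet_derivative n (at w) (axis i 1))
                                  (frechet_derivative Y (at w) (axis j 1)))"

definition mean_curvature :: "(real^2 \<Rightarrow> real^3) \<Rightarrow> (real^2 \<Rightarrow> real^3) \<Rightarrow> real^2 \<Rightarrow> real" where
  "mean_curvature Y n w = trace (matrix_inv (first_form Y w) ** second_form Y n w) / 2"

text \<open>For a symmetric matrix: the bilinear form on the plane with this matrix has signature (+,-).\<close>

definition lorentzian :: "real^2^2 \<Rightarrow> bool" where
  "lorentzian G \<longleftrightarrow> (\<exists>a b. a \<bullet> (G *v a) = 1 \<and> b \<bullet> (G *v b) = -1 \<and> a \<bullet> (G *v b) = 0)"

definition timelike_immersion :: "'m atlas \<Rightarrow> 'm set \<Rightarrow> ('m \<Rightarrow> real^3) \<Rightarrow> bool" where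
  "timelike_immersion A U X \<longleftrightarrow>
     C1_map A U X \<and> (\<forall>q\<in>U. immersed_at A X q) \<and>
     (\<forall>(W, x)\<in>A. \<forall>w\<in>W \<inter> x -` U. lorentzian (first_form (X \<circ> x) w))"

text \<open>A unit normal field with values in \<open>dS\<close>, of class C1.\<close>

definition gauss_map :: "'m atlas \<Rightarrow> 'm set \<Rightarrow> ('m \<Rightarrow> real^3) \<Rightarrow> ('m \<Rightarrow> real^3) \<Rightarrow> bool" where
  "gauss_map A U X n \<longleftrightarrow>
     n ` U \<subseteq> dS \<and> C1_map A U n \<and>
     (\<forall>(W, x)\<in>A. \<forall>w\<in>W \<inter> x -` U. \<forall>v. mink (n (x w)) (frechet_derivative (X \<circ> x) (at w) v) = 0)"

text \<open>Reversing the normal \<open>n\<close> changes the sign of the mean curvature, so vanishing of the mean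
  curvature does not depend on the orientation.\<close>

definition zero_mean_curvature ::
    "'m atlas \<Rightarrow> 'm set \<Rightarrow> ('m \<Rightarrow> real^3) \<Rightarrow> ('m \<Rightarrow> real^3) \<Rightarrow> bool" where
  "zero_mean_curvature A U X n \<longleftrightarrow>
     (\<forall>(W, x)\<in>A. \<forall>w\<in>W \<inter> x -` U. mean_curvature (X \<circ> x) (n \<circ> x) w = 0)"

definition branch_free :: "'m topology \<Rightarrow> 'm atlas \<Rightarrow> ('m \<Rightarrow> real^3) \<Rightarrow> 'm set" where
  "branch_free T A X = {q \<in> topspace T. immersed_at A X q}"

text \<open>\<open>n\<close> maps the open set \<open>U\<close> of the surface C1-diffeomorphically onto an open subset of \<open>dS\<close>.\<close>

definition diffeo_into_dS :: "'m topology \<Rightarrow> 'm atlas \<Rightarrow> 'm set \<Rightarrow> ('m \<Rightarrow> real^3) \<Rightarrow> bool" where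
  "diffeo_into_dS T A U n \<longleftrightarrow>
     openin T U \<and> openin (top_of_set dS) (n ` U) \<and>
     homeomorphic_map (subtopology T U) (top_of_set (n ` U)) n \<and>
     C1_map A U n \<and>
     (\<forall>(W, x)\<in>A. C1_subset (inv_into W x \<circ> inv_into U n) (n ` (U \<inter> x ` W)))"

definition local_diffeo_into_dS :: "'m topology \<Rightarrow> 'm atlas \<Rightarrow> 'm set \<Rightarrow> ('m \<Rightarrow> real^3) \<Rightarrow> bool" where
  "local_diffeo_into_dS T A R n \<longleftrightarrow> (\<forall>q\<in>R. \<exists>U. q \<in> U \<and> U \<subseteq> R \<and> diffeo_into_dS T A U n)"

definition support_fun :: "(real^3 \<Rightarrow> real^3) \<Rightarrow> real^3 \<Rightarrow> real" where
  "support_fun Y p = mink (Y p) p"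

end

theory Submission
  imports Defs
begin

text \<open>Let \<open>A = Hess u + u Id\<close>. Both directions rest on one computation: the differential of
  \<open>X_map u\<close> at \<open>p\<close> is \<open>A\<close>, and it maps the tangent plane of \<open>dS\<close> at \<open>p\<close> into itself
  (lemma \<open>hess_eq\<close>). Hence, where \<open>A\<close> is invertible, the surface has at \<open>X_map u p\<close> the same tangent
  plane as \<open>dS\<close> at \<open>p\<close>. That plane is Lorentzian with unit normal \<open>p\<close>, so the surface is timelike
  and its Gauss map is the inclusion. The differential of the Gauss map is then inverse to \<open>A\<close>, so
  the mean curvature is half the trace of \<open>- A\<^sup>-\<^sup>1\<close>. In dimension two this is
  \<open>- tr A / (2 det A)\<close> (lemma \<open>mean_curvature_eq\<close>), and \<open>tr A\<close> is \<open>box_dS u + 2 u\<close>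
  (lemma \<open>X_map_in_frame\<close>). So a regular point is minimal exactly if the equation for \<open>u\<close> holds
  there.

  For the converse it remains to see that a surface \<open>Y\<close>, parametrized by its normal, is \<open>X_map u\<close>
  for its support function \<open>u p = mink (Y p) p\<close>. Since the differential of \<open>Y\<close> is orthogonal to \<open>p\<close>,
  the differential of \<open>u\<close> at \<open>p\<close> is the product with \<open>Y p\<close>. This says that \<open>grad u p\<close> is the
  tangential part of \<open>Y p\<close>, and it also makes \<open>u\<close> of class C2 although \<open>Y\<close> is only of class C1
  (lemma \<open>support_fun_local\<close>).

  Functions on \<open>dS\<close> are differentiated within \<open>dS\<close>, where a derivative is determined on tangent
  vectors only. Composition with the radial retraction onto \<open>dS\<close> reduces all statements about such
  derivatives to statements about derivatives at interior points.\<close>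


section \<open>Calculus of C1 maps\<close>

text \<open>Checking continuity of the derivative one direction at a time avoids all computation with
  \<open>Blinfun\<close>.\<close>

lemma C1_onI:
  fixes f :: "'a::euclidean_space \<Rightarrow> 'b::real_normed_vector"
  assumes der: "\<And>x. x \<in> S \<Longrightarrow> (f has_derivative f' x) (at x)"
    and cont: "\<And>v. continuous_on S (\<lambda>x. f' x v)"
  shows "C1_on f S"
proof -
  have app: "blinfun_apply (Blinfun (f' x)) = f' x" if "x \<in> S" for x
    using der[OF that] by (simp add: bounded_linear_Blinfun_apply has_derivative_bounded_linear)
  have "continuous_on S (\<lambda>x. Blinfun (f' x))"
    by (rule continuous_on_blinfun_componentwise, rule continuous_on_eq[OF cont]) (simp add: app)
  then show ?thesis
    unfolding C1_on_def using der app by (intro exI[of _ "\<lambda>x. Blinfun (f' x)"]) auto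
qed

lemma C1_onE:
  assumes "C1_on f S"
  obtains f' where "\<And>x. x \<in> S \<Longrightarrow> (f has_derivative f' x) (at x)"
    and "\<And>v. continuous_on S (\<lambda>x. f' x v)"
proof -
  obtain f' where "\<forall>x\<in>S. (f has_derivative blinfun_apply (f' x)) (at x)" "continuous_on S f'"
    using assms unfolding C1_on_def by blast
  then show ?thesis by (intro that[of "\<lambda>x. blinfun_apply (f' x)"]) (auto intro!: continuous_intros)
qed

lemma C1_on_has_derivative:
  assumes "C1_on f S" "x \<in> S"
  shows "(f has_derivative frechet_derivative f (at x)) (at x)"
  using C1_onE[OF assms(1)] assms(2) by (metis differentiableI frechet_derivative_works)

lemma C1_on_imp_continuous_on: "C1_on f S \<Longrightarrow> continuous_on S f"
  by (rule continuous_at_imp_continuous_on) (blast intro: has_derivative_continuous C1_on_has_derivative)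

lemma C1_on_subset: "C1_on f S \<Longrightarrow> T \<subseteq> S \<Longrightarrow> C1_on f T"
  unfolding C1_on_def by (auto intro: continuous_on_subset)

lemma C2_on_imp_C1_on: "C2_on f S \<Longrightarrow> C1_on f S"
  using C1_on_imp_continuous_on unfolding C2_on_def C1_on_def[of f] by blast

lemma C1_on_cong:
  assumes "open S" "\<And>x. x \<in> S \<Longrightarrow> f x = g x" "C1_on f S"
  shows "C1_on g S"
proof -
  obtain f' where "\<forall>x\<in>S. (f has_derivative blinfun_apply (f' x)) (at x)" "continuous_on S f'"
    using assms(3) unfolding C1_on_def by blast
  moreover from this have "(g has_derivative blinfun_apply (f' x)) (at x)" if "x \<in> S" for x
    using that assms by (blast intro: has_derivative_transform_within_open)
  ultimately show ?thesis unfolding C1_on_def by blast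
qed

text \<open>The derivative of a map at a point is unique, so the derivatives found near the single points
  are restrictions of one map, and continuity of that map is a local question.\<close>

lemma C1_on_localI:
  fixes f :: "'a::euclidean_space \<Rightarrow> 'b::real_normed_vector"
  assumes "\<And>x. x \<in> S \<Longrightarrow> \<exists>V. open V \<and> x \<in> V \<and> C1_on f V"
  shows "C1_on f S"
proof (rule C1_onI)
  show "(f has_derivative frechet_derivative f (at x)) (at x)" if "x \<in> S" for x
    using assms[OF that] C1_on_has_derivative by blast
  show "continuous_on S (\<lambda>x. frechet_derivative f (at x) v)" for v
  proof (rule continuous_at_imp_continuous_on, rule ballI)
    fix x assume "x \<in> S"
    then obtain V where V: "open V" "x \<in> V" "C1_on f V" using assms by blast
    obtain f' where f': "\<And>x. x \<in> V \<Longrightarrow> (f has_derivative f' x) (at x)"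
      "\<And>v. continuous_on V (\<lambda>x. f' x v)" using C1_onE[OF V(3)] by metis
    have "continuous_on V (\<lambda>x. frechet_derivative f (at x) v)"
      by (rule continuous_on_eq[OF f'(2)]) (simp add: frechet_derivative_at[OF f'(1), symmetric])
    then show "isCont (\<lambda>x. frechet_derivative f (at x) v) x"
      using V continuous_on_eq_continuous_at by blast
  qed
qed

lemma C1_on_compose:
  assumes f: "C1_on f T" and g: "C1_on g S" and ST: "g ` S \<subseteq> T"
  shows "C1_on (f \<circ> g) S"
proof -
  obtain f' where f': "\<forall>x\<in>T. (f has_derivative blinfun_apply (f' x)) (at x)" "continuous_on T f'"
    using f unfolding C1_on_def by blast
  obtain g' where g': "\<forall>x\<in>S. (g has_derivative blinfun_apply (g' x)) (at x)" "continuous_on S g'"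
    using g unfolding C1_on_def by blast
  have "continuous_on S (\<lambda>x. f' (g x))"
    using continuous_on_compose2[OF f'(2) C1_on_imp_continuous_on[OF g] ST] .
  then have "continuous_on S (\<lambda>x. f' (g x) o\<^sub>L g' x)"
    using g'(2) by (intro continuous_intros)
  moreover have "(f \<circ> g has_derivative blinfun_apply (f' (g x) o\<^sub>L g' x)) (at x)" if "x \<in> S" for x
    using diff_chain_at[of g "g' x" x f "f' (g x)"] f'(1) g'(1) that ST
    by (auto simp: blinfun_compose.rep_eq)
  ultimately show ?thesis
    unfolding C1_on_def by (intro exI[of _ "\<lambda>x. f' (g x) o\<^sub>L g' x"]) simp
qed

lemma C1_on_bounded_linear:
  fixes f :: "'a::euclidean_space \<Rightarrow> 'b::real_normed_vector"
  assumes "bounded_linear L" "C1_on f S"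
  shows "C1_on (\<lambda>x. L (f x)) S"
proof -
  obtain f' where f': "\<And>x. x \<in> S \<Longrightarrow> (f has_derivative f' x) (at x)"
    "\<And>v. continuous_on S (\<lambda>x. f' x v)" using C1_onE[OF assms(2)] by metis
  show ?thesis
    by (rule C1_onI[where f' = "\<lambda>x v. L (f' x v)"])
      (auto intro: bounded_linear.has_derivative[OF assms(1)] bounded_linear.continuous_on[OF assms(1)] f')
qed

lemma C1_on_bounded_bilinear:
  fixes f :: "'a::euclidean_space \<Rightarrow> 'b::real_normed_vector"
  assumes B: "bounded_bilinear B" and "C1_on f S" "C1_on g S"
  shows "C1_on (\<lambda>x. B (f x) (g x)) S"
proof -
  obtain f' where f': "\<And>x. x \<in> S \<Longrightarrow> (f has_derivative f' x) (at x)"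
    "\<And>v. continuous_on S (\<lambda>x. f' x v)" using C1_onE[OF assms(2)] by metis
  obtain g' where g': "\<And>x. x \<in> S \<Longrightarrow> (g has_derivative g' x) (at x)"
    "\<And>v. continuous_on S (\<lambda>x. g' x v)" using C1_onE[OF assms(3)] by metis
  show ?thesis
    by (rule C1_onI[where f' = "\<lambda>x v. B (f x) (g' x v) + B (f' x v) (g x)"])
      (auto intro!: bounded_bilinear.FDERIV[OF B] continuous_on_add
        bounded_bilinear.continuous_on[OF B] f' g' C1_on_imp_continuous_on[OF assms(2)]
        C1_on_imp_continuous_on[OF assms(3)])
qed

lemma C1_on_add:
  fixes f :: "'a::euclidean_space \<Rightarrow> 'b::real_normed_vector"
  assumes "C1_on f S" "C1_on g S"
  shows "C1_on (\<lambda>x. f x + g x) S"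
proof -
  obtain f' where f': "\<And>x. x \<in> S \<Longrightarrow> (f has_derivative f' x) (at x)"
    "\<And>v. continuous_on S (\<lambda>x. f' x v)" using C1_onE[OF assms(1)] by metis
  obtain g' where g': "\<And>x. x \<in> S \<Longrightarrow> (g has_derivative g' x) (at x)"
    "\<And>v. continuous_on S (\<lambda>x. g' x v)" using C1_onE[OF assms(2)] by metis
  show ?thesis
    by (rule C1_onI[where f' = "\<lambda>x v. f' x v + g' x v"])
      (auto intro!: has_derivative_add continuous_on_add f' g')
qed

lemma C1_on_id: "C1_on (\<lambda>x::'a::euclidean_space. x) S"
  by (rule C1_onI[where f' = "\<lambda>x v. v"]) auto


section \<open>The Minkowski product and its tangent planes\<close>

lemma bounded_bilinear_mink: "bounded_bilinear mink"
  unfolding bilinear_conv_bounded_bilinear[symmetric] bilinear_def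
  by (auto intro!: linearI simp: mink_def algebra_simps)

interpretation mink: bounded_bilinear mink
  by (rule bounded_bilinear_mink)

lemma mink_commute: "mink x y = mink y x"
  by (simp add: mink_def)

lemma mink_nondegenerate:
  assumes "\<And>v. mink x v = 0"
  shows "x = 0"
proof -
  have "x $ 1 = 0" "x $ 2 = 0" "x $ 3 = 0"
    using assms[of "axis 1 1"] assms[of "axis 2 1"] assms[of "axis 3 1"]
    by (auto simp: mink_def axis_def)
  then show ?thesis by (simp add: vec_eq_iff forall_3)
qed

lemma mink_dS: "p \<in> dS \<Longrightarrow> mink p p = 1"
  by (simp add: dS_def)

lemma subspace_tangent: "subspace (tangent p)"
  unfolding tangent_def subspace_def by (auto simp: mink.zero_right mink.add_right mink.scaleR_right)

text \<open>The projection onto \<open>tangent p\<close> along the unit normal \<open>p\<close>.\<close>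

definition tangent_proj :: "real^3 \<Rightarrow> real^3 \<Rightarrow> real^3" where
  "tangent_proj p v = v - mink p v *\<^sub>R p"

lemma tangent_proj_in_tangent: "p \<in> dS \<Longrightarrow> tangent_proj p v \<in> tangent p"
  by (simp add: tangent_proj_def tangent_def mink.diff_right mink.scaleR_right mink_dS)

lemma tangent_proj_eq: "v \<in> tangent p \<Longrightarrow> tangent_proj p v = v"
  by (simp add: tangent_proj_def tangent_def)

lemma mink_tangent_proj_commute: "mink (tangent_proj p v) w = mink v (tangent_proj p w)"
  by (simp add: tangent_proj_def mink.diff_left mink.diff_right mink.scaleR_left mink.scaleR_right mink_commute)

text \<open>A tangent vector is orthogonal to the normal \<open>p\<close> anyway, so a tangent vector orthogonal to
  the tangent plane is orthogonal to the whole space.\<close>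

lemma tangent_nondegenerate:
  assumes "p \<in> dS" "x \<in> tangent p" "\<And>v. v \<in> tangent p \<Longrightarrow> mink x v = 0"
  shows "x = 0"
  by (rule mink_nondegenerate) (metis assms mink_tangent_proj_commute tangent_proj_eq tangent_proj_in_tangent)

lemma dim_tangent:
  assumes "p \<in> dS"
  shows "dim (tangent p) = 2"
proof -
  define a :: "real^3" where "a = vector [p $ 1, p $ 2, - (p $ 3)]"
  have "tangent p = {v. a \<bullet> v = 0}"
    by (simp add: tangent_def mink_def a_def inner_vec_def sum_3)
  moreover have "a \<noteq> 0"
  proof
    assume "a = 0"
    then have "a $ 1 = 0" "a $ 2 = 0" "a $ 3 = 0" by simp_all
    then have "p $ 1 = 0" "p $ 2 = 0" "p $ 3 = 0" by (simp_all add: a_def)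
    then show False using mink_dS[OF assms] by (simp add: mink_def)
  qed
  ultimately show ?thesis by (simp add: dim_hyperplane)
qed

text \<open>With \<open>p = (a, b, c)\<close> and \<open>r\<^sup>2 = a\<^sup>2 + b\<^sup>2 = 1 + c\<^sup>2\<close>, the frame is the unit tangent of the parallel circle
  through \<open>p\<close> and the unit tangent of the meridian.\<close>

lemma tangent_orthonormal_frame:
  assumes "p \<in> dS"
  obtains e1 e2 where "e1 \<in> tangent p" "e2 \<in> tangent p"
    "mink e1 e1 = 1" "mink e2 e2 = -1" "mink e1 e2 = 0"
proof -
  define a b c where "a = p $ 1" and "b = p $ 2" and "c = p $ 3"
  have abc: "a * a + b * b = 1 + c * c"
    using mink_dS[OF assms] by (simp add: mink_def a_def b_def c_def)
  define r where "r = sqrt (a * a + b * b)"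
  have "a * a + b * b > 0"
    unfolding abc by (rule add_pos_nonneg) auto
  then have r: "r * r = a * a + b * b" "r \<noteq> 0" "a * a + b * b \<noteq> 0"
    unfolding r_def by (simp_all del: sum_squares_gt_zero_iff sum_squares_eq_zero_iff)
  define e1 e2 :: "real^3" where "e1 = vector [- b / r, a / r, 0]" and "e2 = vector [a * c / r, b * c / r, r]"
  show ?thesis
  proof (rule that[of e1 e2])
    show "e1 \<in> tangent p" "mink e1 e2 = 0"
      by (simp_all add: tangent_def mink_def e1_def e2_def a_def b_def)
    have "a * (a * c / r) + b * (b * c / r) = c * (a * a + b * b) / r"
      by (simp add: algebra_simps add_divide_distrib)
    also have "\<dots> = c * r" using r by (metis nonzero_mult_div_cancel_right mult.assoc)
    finally show "e2 \<in> tangent p"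
      by (simp add: tangent_def mink_def e2_def a_def b_def c_def)
    have "mink e1 e1 = (a * a + b * b) / (r * r)"
      by (simp add: mink_def e1_def add_divide_distrib)
    then show "mink e1 e1 = 1" using r(3) unfolding r(1) by (metis divide_self)
    have "mink e2 e2 = (a * a + b * b) * (c * c) / (r * r) - r * r"
      by (simp add: mink_def e2_def algebra_simps add_divide_distrib)
    also have "\<dots> = c * c - (1 + c * c)" unfolding r(1) using r(3) abc by simp
    finally show "mink e2 e2 = -1" by simp
  qed
qed


section \<open>Endomorphisms of a tangent plane in coordinates\<close>

text \<open>A basis of \<open>tangent p\<close>, given as the isomorphism from the plane that maps the standard basis
  to it. The differential of a local parametrization is of this form, and an endomorphism \<open>A\<close> of
  the tangent plane has the matrix \<open>M\<close> in this basis when \<open>A (L v) = L (M *v v)\<close>.\<close>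

definition tangent_frame :: "real^3 \<Rightarrow> (real^2 \<Rightarrow> real^3) \<Rightarrow> bool" where
  "tangent_frame p L \<longleftrightarrow> linear L \<and> inj L \<and> range L = tangent p"

lemma tangent_frameI:
  assumes "p \<in> dS" "linear L" "inj L" "range L \<subseteq> tangent p"
  shows "tangent_frame p L"
proof -
  have "dim (range L) = 2"
    using dim_image_eq[of L UNIV] assms(2,3) by simp
  then have "range L = tangent p"
    using subspace_dim_equal[of "range L" "tangent p"] assms dim_tangent[OF assms(1)]
      linear_subspace_image[OF assms(2) subspace_UNIV] subspace_tangent by simp
  then show ?thesis using assms by (simp add: tangent_frame_def)
qed

lemma tangent_frame_matrix:
  fixes F :: "real^2 \<Rightarrow> real^3"
  assumes L: "tangent_frame p L" and F: "linear F" "range F \<subseteq> tangent p"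
  obtains M :: "real^2^2" where "\<And>v. F v = L (M *v v)"
proof -
  obtain K where K: "linear K" "K \<circ> L = id"
    using L linear_injective_left_inverse[of L] unfolding tangent_frame_def by blast
  have LK: "L (K z) = z" if "z \<in> tangent p" for z
    using that L K(2) unfolding tangent_frame_def by (metis comp_apply id_apply rangeE)
  have "F v = L (matrix (K \<circ> F) *v v)" for v
    using LK[of "F v"] F(2) matrix_works[of "K \<circ> F" v] linear_compose[OF F(1) K(1)]
    by (simp add: image_subset_iff)
  then show ?thesis by (rule that)
qed

lemma linear_2:
  fixes L :: "real^2 \<Rightarrow> 'a::real_vector"
  assumes "linear L"
  shows "L v = v $ 1 *\<^sub>R L (axis 1 1) + v $ 2 *\<^sub>R L (axis 2 1)"
proof -
  have "v $ 1 *\<^sub>R axis 1 1 + v $ 2 *\<^sub>R axis 2 1 = v"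
    by (simp add: vec_eq_iff forall_2 axis_def)
  moreover have "L (v $ 1 *\<^sub>R axis 1 1 + v $ 2 *\<^sub>R axis 2 1) =
      v $ 1 *\<^sub>R L (axis 1 1) + v $ 2 *\<^sub>R L (axis 2 1)"
    by (simp add: linear_add[OF assms] linear_scale[OF assms])
  ultimately show ?thesis by simp
qed

lemma matrix_vector_axis: "(M *v axis j 1) $ i = (M::real^'n^'m) $ i $ j"
  by (simp add: matrix_vector_mult_basis column_def)

lemma matrix_eq_axisI:
  fixes A B :: "real^'n^'m"
  assumes "\<And>j. A *v axis j 1 = B *v axis j 1"
  shows "A = B"
  by (simp add: vec_eq_iff) (metis assms matrix_vector_axis)

text \<open>A change of basis conjugates the matrix. The hypothesis on the second basis concerns the two
  basis vectors only, because this is all that the definition of \<open>tangent_det\<close> provides; linearity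
  comes from the first basis.\<close>

lemma tangent_frame_similar:
  assumes L: "tangent_frame p L" and L': "tangent_frame p L'"
    and M: "\<And>v. A (L v) = L (M *v v)"
    and M': "\<And>i. A (L' (axis i 1)) = L' (M' *v axis i 1)"
  shows "trace M' = trace M" "det M' = det M"
proof -
  have lin: "linear L" "linear L'" and inj: "inj L" "inj L'" and ran: "range L = tangent p" "range L' = tangent p"
    using L L' by (auto simp: tangent_frame_def)
  obtain Q where Q: "\<And>v. L' v = L (Q *v v)"
    using tangent_frame_matrix[OF L lin(2)] ran by blast
  obtain R where R: "\<And>v. L v = L' (R *v v)"
    using tangent_frame_matrix[OF L' lin(1)] ran by blast
  have "L' ((R ** Q) *v v) = L' v" for v
    by (metis Q R matrix_vector_mul_assoc)
  then have RQ: "R ** Q = mat 1"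
    using inj(2) by (auto simp: matrix_eq inj_def)
  then have QR: "Q ** R = mat 1"
    by (simp add: matrix_left_right_inverse)
  have "L ((M ** Q) *v axis i 1) = L ((Q ** M') *v axis i 1)" for i
    by (metis M M' Q matrix_vector_mul_assoc)
  then have "(M ** Q) *v axis i 1 = (Q ** M') *v axis i 1" for i
    using inj(1) by (auto simp: inj_def)
  then have MQ: "M ** Q = Q ** M'" by (rule matrix_eq_axisI)
  then have M'_eq: "M' = R ** (M ** Q)"
    by (metis RQ matrix_mul_assoc matrix_mul_lid)
  have "trace M' = trace ((M ** Q) ** R)"
    unfolding M'_eq by (rule trace_mul_sym)
  also have "(M ** Q) ** R = M"
    by (metis QR matrix_mul_assoc matrix_mul_rid)
  finally show "trace M' = trace M" .
  have "det R * det Q = 1"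
    by (metis RQ det_I det_mul)
  then show "det M' = det M"
    unfolding M'_eq by (simp add: det_mul)
qed

lemma tangent_det_eq:
  assumes p: "p \<in> dS" and L: "tangent_frame p L" and M: "\<And>v. A (L v) = L (M *v v)"
  shows "tangent_det p A = det M"
  unfolding tangent_det_def
proof (rule the_equality)
  show "\<forall>b1\<in>tangent p. \<forall>b2\<in>tangent p. \<forall>M'::real^2^2.
     b1 \<noteq> b2 \<and> independent {b1, b2} \<and>
     A b1 = M' $ 1 $ 1 *\<^sub>R b1 + M' $ 2 $ 1 *\<^sub>R b2 \<and> A b2 = M' $ 1 $ 2 *\<^sub>R b1 + M' $ 2 $ 2 *\<^sub>R b2
     \<longrightarrow> det M = det M'"
  proof (intro ballI allI impI, elim conjE)
    fix b1 b2 and M' :: "real^2^2"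
    assume b: "b1 \<in> tangent p" "b2 \<in> tangent p" and ind: "b1 \<noteq> b2" "independent {b1, b2}"
      and A: "A b1 = M' $ 1 $ 1 *\<^sub>R b1 + M' $ 2 $ 1 *\<^sub>R b2" "A b2 = M' $ 1 $ 2 *\<^sub>R b1 + M' $ 2 $ 2 *\<^sub>R b2"
    define L' where "L' v = v $ 1 *\<^sub>R b1 + v $ 2 *\<^sub>R b2" for v :: "real^2"
    have lin: "linear L'" by (auto intro!: linearI simp: L'_def algebra_simps)
    have "v = 0" if "L' v = 0" for v
    proof -
      have b2: "b2 \<noteq> 0" "b1 \<notin> span {b2}"
        using ind by (auto simp: independent_insert dependent_zero)
      have "v $ 1 = 0"
      proof (rule ccontr)
        assume "v $ 1 \<noteq> 0"
        then have "b1 = inverse (v $ 1) *\<^sub>R (v $ 1 *\<^sub>R b1)" by simp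
        also have "v $ 1 *\<^sub>R b1 = (- v $ 2) *\<^sub>R b2"
          using that by (simp add: L'_def eq_neg_iff_add_eq_0)
        finally have "b1 \<in> span {b2}"
          by (simp add: span_base span_scale span_neg)
        then show False using b2(2) by contradiction
      qed
      then show ?thesis using that b2 by (auto simp: L'_def vec_eq_iff forall_2)
    qed
    then have "inj L'" using lin by (simp add: linear_injective_0)
    moreover have "range L' \<subseteq> tangent p"
      using b subspace_tangent by (auto simp: L'_def intro!: subspace_add subspace_scale)
    ultimately have L': "tangent_frame p L'" by (rule tangent_frameI[OF p lin])
    have "A (L' (axis i 1)) = L' (M' *v axis i 1)" for i
      using A exhaust_2[of i] by (auto simp: L'_def matrix_vector_axis) (simp_all add: axis_def)
    from tangent_frame_similar(2)[OF L L' M this] show "det M = det M'" by simp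
  qed
next
  fix d
  assume d: "\<forall>b1\<in>tangent p. \<forall>b2\<in>tangent p. \<forall>M::real^2^2.
     b1 \<noteq> b2 \<and> independent {b1, b2} \<and>
     A b1 = M $ 1 $ 1 *\<^sub>R b1 + M $ 2 $ 1 *\<^sub>R b2 \<and> A b2 = M $ 1 $ 2 *\<^sub>R b1 + M $ 2 $ 2 *\<^sub>R b2
     \<longrightarrow> d = det M"
  have lin: "linear L" and inj: "inj L" and ran: "range L = tangent p"
    using L by (auto simp: tangent_frame_def)
  have ax: "independent {axis 1 1, axis 2 1 :: real^2}"
    by (rule independent_mono[OF independent_Basis]) (auto simp: Basis_vec_def)
  have "independent (L ` {axis 1 1, axis 2 1})"
    by (rule linear_independent_injective_image[OF lin ax]) (use inj in \<open>auto intro: inj_on_subset\<close>)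
  moreover have "L (axis 1 1) \<noteq> L (axis 2 1)"
    using inj by (auto simp: inj_eq axis_eq_axis)
  moreover have "A (L (axis j 1)) = M $ 1 $ j *\<^sub>R L (axis 1 1) + M $ 2 $ j *\<^sub>R L (axis 2 1)" for j
    unfolding M linear_2[OF lin, of "M *v axis j 1"] matrix_vector_axis ..
  moreover have "L (axis 1 1) \<in> tangent p" "L (axis 2 1) \<in> tangent p" using ran by auto
  ultimately show "d = det M"
    using d[rule_format, of "L (axis 1 1)" "L (axis 2 1)" M] by auto
qed

text \<open>In an orthonormal frame \<open>e1, e2\<close> the diagonal entries of the matrix of \<open>A\<close> are \<open>mink (A e1) e1\<close>
  and \<open>- mink (A e2) e2\<close>, so every frame gives the trace of a matrix similar to \<open>M\<close>.\<close>

lemma metric_trace_eq: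
  assumes p: "p \<in> dS" and L: "tangent_frame p L" and M: "\<And>v. A (L v) = L (M *v v)"
  shows "metric_trace p A = trace M"
proof -
  have *: "trace M = mink (A e1) e1 - mink (A e2) e2"
    if e: "e1 \<in> tangent p" "e2 \<in> tangent p" "mink e1 e1 = 1" "mink e2 e2 = -1" "mink e1 e2 = 0" for e1 e2
  proof -
    define L' where "L' v = v $ 1 *\<^sub>R e1 + v $ 2 *\<^sub>R e2" for v :: "real^2"
    have lin: "linear L'" by (auto intro!: linearI simp: L'_def algebra_simps)
    have co: "mink (L' v) e1 = v $ 1" "mink (L' v) e2 = - v $ 2" for v
      using e by (simp_all add: L'_def mink.add_left mink.scaleR_left mink_commute[of e2 e1])
    have "v = 0" if "L' v = 0" for v
      using co[of v] that by (simp add: mink.zero_left vec_eq_iff forall_2)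
    then have "inj L'" using lin by (simp add: linear_injective_0)
    moreover have "range L' \<subseteq> tangent p"
      using e subspace_tangent by (auto simp: L'_def intro!: subspace_add subspace_scale)
    ultimately have L': "tangent_frame p L'" by (rule tangent_frameI[OF p lin])
    have linL: "linear L" and ran: "range L = tangent p" using L by (auto simp: tangent_frame_def)
    obtain Q where Q: "\<And>v. L' v = L (Q *v v)"
      using tangent_frame_matrix[OF L lin \<open>range L' \<subseteq> tangent p\<close>] by blast
    have "A \<circ> L' = L \<circ> (\<lambda>v. (M ** Q) *v v)"
      by (auto simp: Q M matrix_vector_mul_assoc)
    then have "linear (A \<circ> L')"
      using linear_compose[OF matrix_vector_mul_linear linL] by metis
    moreover have "range (A \<circ> L') \<subseteq> tangent p"
      using ran by (auto simp: Q M)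
    ultimately obtain M' where M': "\<And>v. (A \<circ> L') v = L' (M' *v v)"
      using tangent_frame_matrix[OF L'] by blast
    have ax: "L' (axis 1 1) = e1" "L' (axis 2 1) = e2"
      by (simp_all add: L'_def axis_def)
    have "mink (A e1) e1 = M' $ 1 $ 1"
      using M'[of "axis 1 1"] by (simp add: ax co matrix_vector_axis)
    moreover have "mink (A e2) e2 = - M' $ 2 $ 2"
      using M'[of "axis 2 1"] by (simp add: ax co matrix_vector_axis)
    moreover have "trace M' = trace M"
      using tangent_frame_similar(1)[OF L L' M, of M'] M' by simp
    ultimately show ?thesis by (simp add: trace_def sum_2)
  qed
  obtain e1 e2 where e: "e1 \<in> tangent p" "e2 \<in> tangent p"
    "mink e1 e1 = 1" "mink e2 e2 = -1" "mink e1 e2 = 0" by (rule tangent_orthonormal_frame[OF p])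
  show ?thesis
    unfolding metric_trace_def using e by (intro the_equality) (use * in auto)
qed

text \<open>The matrix of the bilinear form \<open>mink (F x) (H y)\<close>. The first fundamental form of a surface
  with differential \<open>F\<close> is \<open>gram F F\<close>; the second one, for a normal with differential \<open>L\<close>, is
  \<open>- gram L F\<close>.\<close>

definition gram :: "(real^2 \<Rightarrow> real^3) \<Rightarrow> (real^2 \<Rightarrow> real^3) \<Rightarrow> real^2^2" where
  "gram F H = (\<chi> i j. mink (F (axis i 1)) (H (axis j 1)))"

lemma gram_form:
  assumes "linear F" "linear H"
  shows "x \<bullet> (gram F H *v y) = mink (F x) (H y)"
  unfolding linear_2[OF assms(1), of x] linear_2[OF assms(2), of y]
  by (simp add: gram_def inner_vec_def matrix_vector_mult_def sum_2 mink.add_left mink.add_right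
      mink.scaleR_left mink.scaleR_right algebra_simps)

lemma matrix_eq_formI:
  fixes A B :: "real^'n^'m"
  assumes "\<And>x y. x \<bullet> (A *v y) = x \<bullet> (B *v y)"
  shows "A = B"
proof -
  have "A *v y = B *v y" for y
    using vector_eq_rdot[of "A *v y" "B *v y"] assms by (simp add: inner_commute)
  then show ?thesis by (simp add: matrix_eq)
qed

lemma matrix_inv_eqI:
  fixes A B :: "real^'n^'n"
  assumes "A ** B = mat 1"
  shows "matrix_inv A = B"
proof -
  have BA: "B ** A = mat 1" using assms by (simp add: matrix_left_right_inverse)
  have "A ** matrix_inv A = mat 1 \<and> matrix_inv A ** A = mat 1"
    unfolding matrix_inv_def by (rule someI[of _ B]) (simp add: assms BA)
  then show ?thesis by (metis BA matrix_mul_assoc matrix_mul_lid matrix_mul_rid)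
qed

text \<open>The inverse of a matrix of size two is its adjugate divided by the determinant, and the
  adjugate has the same trace as the matrix.\<close>

lemma trace_inverse_2:
  fixes M N :: "real^2^2"
  assumes "M ** N = mat 1"
  shows "det M * trace N = trace M"
proof -
  have *: "N ** M = mat 1" using assms by (simp add: matrix_left_right_inverse)
  have "M$1$1 * N$1$1 + M$1$2 * N$2$1 = 1" "M$1$1 * N$1$2 + M$1$2 * N$2$2 = 0"
    "M$2$1 * N$1$1 + M$2$2 * N$2$1 = 0" "M$2$1 * N$1$2 + M$2$2 * N$2$2 = 1"
    using assms by (simp_all add: vec_eq_iff forall_2 matrix_matrix_mult_def mat_def sum_2)
  then show ?thesis unfolding det_2 trace_def sum_2 by algebra
qed

lemma gram_invertible:
  assumes p: "p \<in> dS" and L: "tangent_frame p L"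
  obtains gi where "gram L L ** gi = mat 1"
proof -
  have lin: "linear L" and inj: "inj L" and ran: "range L = tangent p"
    using L by (auto simp: tangent_frame_def)
  have "x = 0" if "gram L L *v x = 0" for x
  proof -
    have "mink (L x) (L y) = 0" for y
      using gram_form[OF lin lin, of y x] that by (simp add: mink_commute)
    then have "L x = 0" using tangent_nondegenerate[OF p] ran by (metis rangeE rangeI)
    then show ?thesis using lin inj by (metis linear_injective_0)
  qed
  then have "inj ((*v) (gram L L))"
    by (simp add: linear_injective_0)
  then show ?thesis
    using that by (metis matrix_left_invertible_injective matrix_left_right_inverse)
qed

text \<open>Let \<open>g = gram L L\<close>. Then \<open>gram F F = M\<^sup>T g M\<close> and \<open>gram L F = g M\<close>, so the product under the trace
  is \<open>M\<^sup>-\<^sup>1 (g\<^sup>-\<^sup>1 M\<^sup>-\<^sup>T g) M\<close>. It is similar to \<open>M\<^sup>-\<^sup>T\<close>, whatever \<open>g\<close> is, and so its trace is that of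
  \<open>M\<^sup>-\<^sup>1\<close>.\<close>

lemma trace_gram:
  assumes p: "p \<in> dS" and L: "tangent_frame p L" and F: "\<And>v. F v = L (M *v v)" and M: "det M \<noteq> 0"
  shows "trace (matrix_inv (gram F F) ** gram L F) = trace M / det M"
proof -
  have lin: "linear L" using L by (auto simp: tangent_frame_def)
  have "F = L \<circ> (*v) M" using F by auto
  then have linF: "linear F"
    using linear_compose[OF matrix_vector_mul_linear lin, of M] by simp
  obtain N where N: "M ** N = mat 1"
    using M invertible_det_nz[of M] by (auto simp: invertible_right_inverse)
  then have NM: "N ** M = mat 1" by (simp add: matrix_left_right_inverse)
  obtain gi where gi: "gram L L ** gi = mat 1" by (rule gram_invertible[OF p L])
  have LF: "gram L F = gram L L ** M"
    by (rule matrix_eq_formI)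
      (simp add: gram_form[OF lin linF] gram_form[OF lin lin] F flip: matrix_vector_mul_assoc)
  have FF: "gram F F = transpose M ** gram L L ** M"
  proof (rule matrix_eq_formI)
    fix x y
    have "x \<bullet> (transpose M ** gram L L ** M *v y) = (M *v x) \<bullet> (gram L L *v (M *v y))"
      by (metis dot_lmul_matrix matrix_vector_mul_assoc transpose_matrix_vector transpose_transpose)
    then show "x \<bullet> (gram F F *v y) = x \<bullet> (transpose M ** gram L L ** M *v y)"
      by (simp add: gram_form[OF linF linF] gram_form[OF lin lin] F)
  qed
  have "transpose M ** transpose N = mat 1"
    by (metis NM matrix_transpose_mul transpose_mat)
  then have "gram F F ** (N ** gi ** transpose N) = mat 1"
    unfolding FF by (metis (no_types) N gi matrix_mul_assoc matrix_mul_rid)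
  from matrix_inv_eqI[OF this]
  have "trace (matrix_inv (gram F F) ** gram L F) = trace (N ** (gi ** transpose N ** gram L L ** M))"
    unfolding LF by (simp add: matrix_mul_assoc)
  also have "\<dots> = trace (gi ** transpose N ** gram L L ** M ** N)"
    by (rule trace_mul_sym)
  also have "\<dots> = trace (gi ** (transpose N ** gram L L))"
    by (metis N matrix_mul_assoc matrix_mul_rid)
  also have "\<dots> = trace (transpose N ** gram L L ** gi)"
    by (rule trace_mul_sym)
  also have "\<dots> = trace (transpose N)"
    by (metis gi matrix_mul_assoc matrix_mul_rid)
  also have "\<dots> = trace N" by (simp add: trace_def transpose_def)
  finally show ?thesis using trace_inverse_2[OF N] M by (simp add: field_simps)
qed

text \<open>The form is the restriction of \<open>mink\<close> to \<open>tangent p\<close>, transported by an isomorphism.\<close>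

lemma lorentzian_gram:
  assumes p: "p \<in> dS" and F: "tangent_frame p F"
  shows "lorentzian (gram F F)"
proof -
  have lin: "linear F" and ran: "range F = tangent p" using F by (auto simp: tangent_frame_def)
  obtain e1 e2 where e: "e1 \<in> tangent p" "e2 \<in> tangent p"
    "mink e1 e1 = 1" "mink e2 e2 = -1" "mink e1 e2 = 0" by (rule tangent_orthonormal_frame[OF p])
  then obtain a b where "e1 = F a" "e2 = F b" using ran by (metis rangeE)
  then show ?thesis using e unfolding lorentzian_def by (auto simp: gram_form[OF lin lin])
qed

lemma first_form_eq:
  assumes "(Y has_derivative F) (at w)"
  shows "first_form Y w = gram F F"
  by (simp add: first_form_def gram_def frechet_derivative_at[OF assms, symmetric])

text \<open>If the differential of a surface is \<open>A \<circ> L\<close>, where \<open>L\<close> is the differential of its normal \<open>n\<close>,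
  then \<open>A\<close>, with matrix \<open>M\<close>, is the inverse of the differential of the Gauss map, so that the
  shape operator is \<open>- A\<^sup>-\<^sup>1\<close>. Hence the surface is minimal exactly where \<open>A\<close> has trace zero.\<close>

lemma mean_curvature_eq:
  assumes p: "p \<in> dS" and L: "tangent_frame p L" and F: "\<And>v. F v = L (M *v v)" and M: "det M \<noteq> 0"
    and Y: "(Y has_derivative F) (at w)" and n: "(n has_derivative L) (at w)"
  shows "mean_curvature Y n w = - (trace M / det M) / 2"
proof -
  have "second_form Y n w = - gram L F"
    by (simp add: second_form_def gram_def frechet_derivative_at[OF Y, symmetric]
        frechet_derivative_at[OF n, symmetric] vec_eq_iff)
  moreover have "trace (A ** (- B)) = - trace (A ** B)" for A B :: "real^2^2"
    by (simp add: trace_def matrix_matrix_mult_def sum_negf)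
  ultimately show ?thesis
    by (simp add: mean_curvature_def first_form_eq[OF Y] trace_gram[OF p L F M])
qed


section \<open>Differentiation on the de Sitter plane\<close>

text \<open>The radial retraction of the cone of spacelike vectors onto \<open>dS\<close>. Composition with it turns
  derivatives within \<open>dS\<close> into derivatives at interior points of the ambient space.\<close>

definition dS_retraction :: "real^3 \<Rightarrow> real^3" where
  "dS_retraction y = inverse (sqrt (mink y y)) *\<^sub>R y"

lemma open_spacelike: "open {y. 0 < mink y y}"
  by (rule open_Collect_less) (auto intro!: continuous_intros mink.continuous_on)

lemma dS_retraction_in_dS: "0 < mink y y \<Longrightarrow> dS_retraction y \<in> dS"
  by (simp add: dS_def dS_retraction_def mink.scaleR_left mink.scaleR_right flip: mult.assoc inverse_mult_distrib)

lemma dS_retraction_eq: "y \<in> dS \<Longrightarrow> dS_retraction y = y"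
  by (simp add: dS_retraction_def mink_dS)

lemma has_derivative_inverse_mink_norm:
  assumes "0 < mink y y"
  shows "((\<lambda>y. inverse (sqrt (mink y y))) has_derivative
    (\<lambda>v. - mink y v * inverse (sqrt (mink y y)) ^ 3)) (at y)"
proof -
  have m: "((\<lambda>y. mink y y) has_derivative (\<lambda>v. mink y v + mink v y)) (at y)"
    by (rule mink.FDERIV[OF has_derivative_ident has_derivative_ident])
  have d: "((\<lambda>t. inverse (sqrt t)) has_field_derivative - (inverse (sqrt t) ^ 3) / 2) (at t)" if "0 < t" for t
    using that by (auto intro!: derivative_eq_intros simp: power3_eq_cube field_simps)
  show ?thesis
    by (rule has_derivative_eq_rhs[OF DERIV_compose_FDERIV[OF d[OF assms] m]])
      (auto simp: mink_commute field_simps)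
qed

lemma C1_on_dS_retraction: "C1_on dS_retraction {y. 0 < mink y y}"
proof -
  have "C1_on (\<lambda>y. inverse (sqrt (mink y y))) {y. 0 < mink y y}"
    by (rule C1_onI[OF has_derivative_inverse_mink_norm])
      (auto intro!: continuous_intros mink.continuous_on)
  from C1_on_bounded_bilinear[OF bounded_bilinear_scaleR this C1_on_id]
  show ?thesis unfolding dS_retraction_def[abs_def] .
qed

lemma has_derivative_dS_retraction:
  assumes "p \<in> dS"
  shows "(dS_retraction has_derivative tangent_proj p) (at p)"
  unfolding dS_retraction_def[abs_def]
  by (rule has_derivative_eq_rhs[OF has_derivative_scaleR[OF has_derivative_inverse_mink_norm has_derivative_ident]])
    (auto simp: mink_dS[OF assms] tangent_proj_def)

lemma has_derivative_compose_dS_retraction: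
  assumes p: "p \<in> dS" and F: "(F has_derivative D) (at p within dS)"
  shows "(F \<circ> dS_retraction has_derivative D \<circ> tangent_proj p) (at p)"
proof -
  let ?C = "{y. 0 < mink y y}"
  have p': "p \<in> ?C" using p by (simp add: mink_dS)
  have "(F has_derivative D) (at (dS_retraction p) within dS_retraction ` ?C)"
    unfolding dS_retraction_eq[OF p] by (rule has_derivative_subset[OF F]) (auto simp: dS_retraction_in_dS)
  then have "(F \<circ> dS_retraction has_derivative D \<circ> tangent_proj p) (at p within ?C)"
    using diff_chain_within[OF has_derivative_at_withinI[OF has_derivative_dS_retraction[OF p]]] by blast
  then show ?thesis
    using at_within_open[OF p' open_spacelike] by simp
qed

text \<open>Derivatives in the ambient space are unique, and \<open>F \<circ> dS_retraction\<close> has such a derivative, which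
  agrees with the derivative of \<open>F\<close> on tangent vectors.\<close>

lemma derivative_within_dS_unique:
  assumes "p \<in> dS" "(F has_derivative D) (at p within dS)" "(F has_derivative D') (at p within dS)"
    "v \<in> tangent p"
  shows "D v = D' v"
proof -
  have "D \<circ> tangent_proj p = D' \<circ> tangent_proj p"
    using assms by (blast intro: has_derivative_unique has_derivative_compose_dS_retraction)
  then show ?thesis using tangent_proj_eq[OF assms(4)] by (metis comp_apply)
qed

text \<open>On \<open>dS\<close> the maps \<open>F\<close> and \<open>F \<circ> dS_retraction\<close> coincide, so a derivative within \<open>dS\<close> may be changed
  arbitrarily in the normal direction; here it is made to vanish there.\<close>

lemma has_derivative_within_dS_tangent_proj:
  assumes p: "p \<in> dS" and F: "(F has_derivative D) (at p within dS)"
  shows "(F has_derivative D \<circ> tangent_proj p) (at p within dS)"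
  by (rule has_derivative_transform_within[OF has_derivative_at_withinI[OF
        has_derivative_compose_dS_retraction[OF assms]] zero_less_one p])
    (simp add: dS_retraction_eq)

text \<open>The intrinsic gradient is the tangential part of any vector that represents a derivative
  within \<open>dS\<close>, in particular of the ambient gradient of any extension.\<close>

lemma grad_eq:
  assumes p: "p \<in> dS" and u: "(u has_derivative mink z) (at p within dS)"
  shows "grad u p = tangent_proj p z" "(u has_derivative mink (tangent_proj p z)) (at p within dS)"
proof -
  have "mink (tangent_proj p z) = mink z \<circ> tangent_proj p"
    by (auto simp: mink_tangent_proj_commute)
  then show d: "(u has_derivative mink (tangent_proj p z)) (at p within dS)"
    using has_derivative_within_dS_tangent_proj[OF assms] by simp
  show "grad u p = tangent_proj p z"
    unfolding grad_def
  proof (rule the_equality)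
    show "tangent_proj p z \<in> tangent p \<and> (u has_derivative mink (tangent_proj p z)) (at p within dS)"
      using d tangent_proj_in_tangent[OF p] by blast
    fix v assume v: "v \<in> tangent p \<and> (u has_derivative mink v) (at p within dS)"
    have "v - tangent_proj p z = 0"
    proof (rule tangent_nondegenerate[OF p])
      show "v - tangent_proj p z \<in> tangent p"
        using v tangent_proj_in_tangent[OF p] subspace_tangent by (blast intro: subspace_diff)
      show "mink (v - tangent_proj p z) w = 0" if "w \<in> tangent p" for w
        using derivative_within_dS_unique[OF p _ d that] v by (simp add: mink.diff_left)
    qed
    then show "v = tangent_proj p z" by simp
  qed
qed

lemma has_derivative_within_dS_transform:
  assumes \<Omega>: "openin (top_of_set dS) \<Omega>" "p \<in> \<Omega>" and V: "open V" "p \<in> V"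
    and eq: "\<And>y. y \<in> V \<Longrightarrow> y \<in> \<Omega> \<Longrightarrow> f y = g y"
    and f: "(f has_derivative D) (at p within dS)"
  shows "(g has_derivative D) (at p within dS)"
proof -
  obtain O' where O': "open O'" "\<Omega> = dS \<inter> O'" using \<Omega>(1) by (auto simp: openin_open)
  then obtain e where e: "e > 0" "ball p e \<subseteq> V \<inter> O'"
    using V \<Omega>(2) by (metis IntD2 IntI open_Int open_contains_ball)
  show ?thesis
    by (rule has_derivative_transform_within[OF f e(1)])
      (use e(2) O' \<Omega>(2) eq in \<open>auto simp: dist_commute subset_iff\<close>)
qed

lemma has_derivative_within_dS_compose:
  assumes W: "open W" "w \<in> W" "\<phi> ` W \<subseteq> dS" and \<phi>: "(\<phi> has_derivative L) (at w)"
    and F: "(F has_derivative S) (at (\<phi> w) within dS)"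
  shows "(F \<circ> \<phi> has_derivative S \<circ> L) (at w)"
proof -
  have "(F \<circ> \<phi> has_derivative S \<circ> L) (at w within W)"
    using diff_chain_within[OF has_derivative_at_withinI[OF \<phi>] has_derivative_subset[OF F W(3)]] .
  then show ?thesis using at_within_open[OF W(2,1)] by simp
qed

lemma derivative_into_dS_tangent:
  assumes W: "open W" "w \<in> W" "\<phi> ` W \<subseteq> dS" and \<phi>: "(\<phi> has_derivative L) (at w)"
  shows "L v \<in> tangent (\<phi> w)"
proof -
  have "((\<lambda>w. mink (\<phi> w) (\<phi> w)) has_derivative (\<lambda>v. mink (\<phi> w) (L v) + mink (L v) (\<phi> w))) (at w)"
    by (rule mink.FDERIV[OF \<phi> \<phi>])
  moreover have "((\<lambda>w. mink (\<phi> w) (\<phi> w)) has_derivative (\<lambda>v. 0)) (at w)"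
    by (rule has_derivative_transform_within_open[OF has_derivative_const[of 1] W(1,2)])
      (use W(3) mink_dS in auto)
  ultimately have "mink (\<phi> w) (L v) + mink (L v) (\<phi> w) = 0"
    by (metis has_derivative_unique)
  then show ?thesis by (simp add: tangent_def mink_commute)
qed


section \<open>The support function and the map \<open>X_map\<close>\<close>

text \<open>The vector that represents a linear functional with respect to \<open>mink\<close>; it turns the derivative
  of a function into its ambient gradient.\<close>

definition mink_riesz :: "((real^3) \<Rightarrow>\<^sub>L real) \<Rightarrow> real^3" where
  "mink_riesz \<phi> = \<phi> (axis 1 1) *\<^sub>R axis 1 1 + \<phi> (axis 2 1) *\<^sub>R axis 2 1 - \<phi> (axis 3 1) *\<^sub>R axis 3 1"

lemma bounded_linear_mink_riesz: "bounded_linear mink_riesz"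
  unfolding mink_riesz_def[abs_def]
  by (intro bounded_linear_add bounded_linear_sub
      bounded_linear_compose[OF bounded_linear_scaleR_left] blinfun.bounded_linear_left)

lemma mink_riesz: "mink (mink_riesz \<phi>) v = \<phi> v"
proof -
  have "v = v $ 1 *\<^sub>R axis 1 1 + v $ 2 *\<^sub>R axis 2 1 + v $ 3 *\<^sub>R axis 3 1"
    by (simp add: vec_eq_iff forall_3 axis_def)
  then have "\<phi> v = \<phi> (v $ 1 *\<^sub>R axis 1 1 + v $ 2 *\<^sub>R axis 2 1 + v $ 3 *\<^sub>R axis 3 1)" by simp
  also have "\<dots> = mink (mink_riesz \<phi>) v"
    by (simp add: blinfun.add_right blinfun.scaleR_right mink_def mink_riesz_def axis_def)
  finally show ?thesis by simp
qed

text \<open>Near a point, \<open>grad u\<close> is the tangential part of the ambient gradient \<open>G\<close> of a C2 extension of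
  \<open>u\<close>. This expression makes sense off \<open>dS\<close> as well and gives a C1 extension of \<open>X_map u\<close>.\<close>

lemma C2_subset_X_map:
  assumes \<Omega>: "openin (top_of_set dS) \<Omega>" and u: "C2_subset u \<Omega>"
  shows "C1_subset (X_map u) \<Omega>"
    and "\<And>p. p \<in> \<Omega> \<Longrightarrow> grad u p \<in> tangent p"
    and "\<And>p. p \<in> \<Omega> \<Longrightarrow> (u has_derivative mink (grad u p)) (at p within dS)"
proof -
  have dS: "p \<in> dS" if "p \<in> \<Omega>" for p using that \<Omega> openin_imp_subset by blast
  have *: "\<exists>V h. open V \<and> p \<in> V \<and> C1_on h V \<and> (\<forall>y\<in>V \<inter> \<Omega>. h y = X_map u y \<and>
      grad u y \<in> tangent y \<and> (u has_derivative mink (grad u y)) (at y within dS))" if p: "p \<in> \<Omega>" for p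
  proof -
    obtain V g where V: "open V" "p \<in> V" "C2_on g V" "\<forall>x\<in>V \<inter> \<Omega>. g x = u x"
      using bspec[OF u[unfolded C2_subset_def] p] by (elim exE conjE)
    obtain g' where g': "\<And>x. x \<in> V \<Longrightarrow> (g has_derivative blinfun_apply (g' x)) (at x)" "C1_on g' V"
      using V(3) unfolding C2_on_def by blast
    define G where "G x = mink_riesz (g' x)" for x
    have G: "C1_on G V"
      unfolding G_def by (rule C1_on_bounded_linear[OF bounded_linear_mink_riesz g'(2)])
    have g: "C1_on g V" by (rule C2_on_imp_C1_on[OF V(3)])
    define h where "h y = g y *\<^sub>R y + (G y + (- mink (G y) y) *\<^sub>R y)" for y
    have "C1_on (\<lambda>y. - mink (G y) y) V"
      by (rule C1_on_bounded_linear[OF bounded_linear_minus[OF bounded_linear_ident]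
            C1_on_bounded_bilinear[OF bounded_bilinear_mink G C1_on_id]])
    then have "C1_on h V"
      unfolding h_def
      by (intro C1_on_add G C1_on_bounded_bilinear[OF bounded_bilinear_scaleR] g C1_on_id)
    moreover have "h y = X_map u y \<and> grad u y \<in> tangent y \<and>
        (u has_derivative mink (grad u y)) (at y within dS)" if y: "y \<in> V \<inter> \<Omega>" for y
    proof -
      have "blinfun_apply (g' y) = mink (G y)"
        by (auto simp: G_def mink_riesz)
      then have "(u has_derivative mink (G y)) (at y within dS)"
        using g'(1)[of y] y V(4) 
        by (intro has_derivative_within_dS_transform[OF \<Omega> _ V(1), of y g u])
          (auto intro: has_derivative_at_withinI)
      with y dS have gr: "grad u y = tangent_proj y (G y)" "(u has_derivative mink (tangent_proj y (G y))) (at y within dS)"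
        using grad_eq by blast+
      moreover have "h y = X_map u y"
        using y V(4) by (simp add: h_def X_map_def gr(1) tangent_proj_def mink_commute)
      ultimately show ?thesis using y dS tangent_proj_in_tangent by auto
    qed
    ultimately show ?thesis using V by blast
  qed
  show "C1_subset (X_map u) \<Omega>"
    unfolding C1_subset_def using * by meson
  show "\<And>p. p \<in> \<Omega> \<Longrightarrow> grad u p \<in> tangent p"
    "\<And>p. p \<in> \<Omega> \<Longrightarrow> (u has_derivative mink (grad u p)) (at p within dS)"
    using * by blast+
qed

lemma C1_subset_differentiable_within_dS:
  assumes \<Omega>: "openin (top_of_set dS) \<Omega>" and F: "C1_subset F \<Omega>" and p: "p \<in> \<Omega>"
  obtains D where "(F has_derivative D) (at p within dS)"
proof -
  obtain V g where V: "open V" "p \<in> V" "C1_on g V" "\<forall>x\<in>V \<inter> \<Omega>. g x = F x"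
    using bspec[OF F[unfolded C1_subset_def] p] by (elim exE conjE)
  have "(F has_derivative frechet_derivative g (at p)) (at p within dS)"
    by (rule has_derivative_within_dS_transform[OF \<Omega> p V(1,2), of g])
      (use V(4) has_derivative_at_withinI[OF C1_on_has_derivative[OF V(3,2)]] in auto)
  then show ?thesis by (rule that)
qed

text \<open>The key identity: the differential of \<open>X_map u\<close> is \<open>Hess u + u Id\<close>, an endomorphism of the
  tangent plane. Differentiation of \<open>u y = mink (X_map u y) y\<close> shows that the values are tangent:
  the product rule gives \<open>mink (S Y) p\<close> in addition to \<open>mink (grad u p) Y\<close>, which is already the
  full derivative of \<open>u\<close>. The formula for the Hessian is the tangential part of the derivative of
  \<open>grad u = X_map u - u Id\<close>.\<close>

lemma hess_eq:
  assumes \<Omega>: "openin (top_of_set dS) \<Omega>" and u: "C2_subset u \<Omega>" and p: "p \<in> \<Omega>"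
    and S: "(X_map u has_derivative S) (at p within dS)" and Y: "Y \<in> tangent p"
  shows "S Y \<in> tangent p" "hess u p Y = S Y - u p *\<^sub>R Y"
proof -
  have sub: "\<Omega> \<subseteq> dS" and pdS: "p \<in> dS" using \<Omega> p openin_imp_subset by blast+
  have du: "(u has_derivative mink (grad u p)) (at p within dS)"
    by (rule C2_subset_X_map(3)[OF \<Omega> u p])
  have "((\<lambda>y. mink (X_map u y) y) has_derivative (\<lambda>v. mink (X_map u p) v + mink (S v) p)) (at p within dS)"
    by (rule mink.FDERIV[OF S has_derivative_ident])
  then have "(u has_derivative (\<lambda>v. mink (X_map u p) v + mink (S v) p)) (at p within dS)"
  proof (rule has_derivative_within_dS_transform[OF \<Omega> p open_UNIV UNIV_I, rotated])
    show "mink (X_map u y) y = u y" if "y \<in> \<Omega>" for y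
      using C2_subset_X_map(2)[OF \<Omega> u that] that sub
      by (auto simp: X_map_def mink.add_left mink.scaleR_left tangent_def mink_commute[of "grad u y"] mink_dS)
  qed
  from derivative_within_dS_unique[OF pdS this du Y]
  have *: "mink (S Y) p = 0"
    using Y by (simp add: X_map_def mink.add_left mink.scaleR_left tangent_def)
  then show "S Y \<in> tangent p" by (simp add: tangent_def mink_commute)
  have "((\<lambda>y. X_map u y - u y *\<^sub>R y) has_derivative
      (\<lambda>v. S v - (u p *\<^sub>R v + mink (grad u p) v *\<^sub>R p))) (at p within dS)"
    by (rule has_derivative_diff[OF S has_derivative_scaleR[OF du has_derivative_ident]])
  then have d: "(grad u has_derivative (\<lambda>v. S v - (u p *\<^sub>R v + mink (grad u p) v *\<^sub>R p))) (at p within dS)"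
    by (simp add: X_map_def)
  have "(grad u has_derivative frechet_derivative (grad u) (at p within dS)) (at p within dS)"
    using d frechet_derivative_works differentiableI by blast
  from derivative_within_dS_unique[OF pdS this d Y]
  have D: "frechet_derivative (grad u) (at p within dS) Y = S Y - (u p *\<^sub>R Y + mink (grad u p) Y *\<^sub>R p)" .
  have "mink Y p = 0" using Y by (simp add: tangent_def mink_commute)
  then show "hess u p Y = S Y - u p *\<^sub>R Y"
    using * mink_dS[OF pdS] unfolding hess_def covariant_deriv_def D Let_def
    by (simp add: mink.diff_left mink.add_left mink.scaleR_left)
qed

text \<open>In a basis of the tangent plane, the regularity condition and the equation for \<open>u\<close> are the
  conditions that the matrix of the differential of \<open>X_map u\<close> has nonzero determinant and zero
  trace.\<close>

lemma X_map_in_frame: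
  assumes \<Omega>: "openin (top_of_set dS) \<Omega>" and u: "C2_subset u \<Omega>" and p: "p \<in> \<Omega>"
    and S: "(X_map u has_derivative S) (at p within dS)" and L: "tangent_frame p L"
  obtains M :: "real^2^2" where "\<And>v. S (L v) = L (M *v v)"
    "tangent_det p (\<lambda>Y. hess u p Y + u p *\<^sub>R Y) = det M" "box_dS u p + 2 * u p = trace M"
proof -
  have pdS: "p \<in> dS" using \<Omega> p openin_imp_subset by blast
  have lin: "linear L" and ran: "range L = tangent p" using L by (auto simp: tangent_frame_def)
  have tan: "L v \<in> tangent p" for v using ran by auto
  have "linear (S \<circ> L)"
    by (rule linear_compose[OF lin has_derivative_linear[OF S]])
  moreover have "range (S \<circ> L) \<subseteq> tangent p"
    using hess_eq(1)[OF \<Omega> u p S tan] by auto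
  ultimately obtain M where M: "\<And>v. (S \<circ> L) v = L (M *v v)"
    using tangent_frame_matrix[OF L] by blast
  have h: "hess u p (L v) = L (M *v v) - u p *\<^sub>R L v" for v
    using hess_eq(2)[OF \<Omega> u p S tan, of v] M by simp
  have "hess u p (L v) = L ((M - mat (u p)) *v v)" for v
  proof -
    have "mat (u p) *v v = u p *\<^sub>R v"
      by (simp add: vec_eq_iff forall_2 matrix_vector_mult_def mat_def sum_2)
    then show ?thesis
      unfolding h by (simp add: linear_diff[OF lin] linear_scale[OF lin] matrix_vector_mult_diff_rdistrib)
  qed
  from metric_trace_eq[OF pdS L this]
  have "box_dS u p + 2 * u p = trace M"
    by (simp add: box_dS_def trace_sub) (simp add: trace_def mat_def sum_2)
  moreover have "tangent_det p (\<lambda>Y. hess u p Y + u p *\<^sub>R Y) = det M"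
    by (rule tangent_det_eq[OF pdS L]) (simp add: h)
  ultimately show ?thesis using M by (intro that) auto
qed

lemma bounded_linear_Blinfun_mink: "bounded_linear (\<lambda>z. Blinfun (mink z))"
  unfolding linear_conv_bounded_linear[symmetric]
  by (rule linearI; rule blinfun_eqI)
    (simp_all add: bounded_linear_Blinfun_apply mink.bounded_linear_right blinfun.add_left
      blinfun.scaleR_left mink.add_left mink.scaleR_left)

text \<open>The support function of a C1 map \<open>Y\<close> with unit normal \<open>y\<close> at \<open>Y y\<close> is of class C2, one class
  better than its definition suggests. Indeed its extension \<open>g\<close> that is homogeneous of degree one
  has the ambient gradient \<open>H \<circ> dS_retraction\<close>: the other term of the product rule, which contains the
  derivative of \<open>H\<close>, vanishes because this derivative is orthogonal to \<open>y\<close>.\<close>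

lemma support_fun_local:
  assumes \<Omega>: "openin (top_of_set dS) \<Omega>" and p: "p \<in> \<Omega>"
    and V: "open V" "p \<in> V" and H: "C1_on H V" and eq: "\<And>y. y \<in> V \<inter> \<Omega> \<Longrightarrow> H y = Y y"
    and normal: "\<And>y v. y \<in> V \<inter> \<Omega> \<Longrightarrow> mink y (frechet_derivative H (at y) v) = 0"
  shows "\<exists>V' g. open V' \<and> p \<in> V' \<and> C2_on g V' \<and> (\<forall>y\<in>V' \<inter> dS. y \<in> \<Omega> \<and> g y = support_fun Y y)"
    and "(support_fun Y has_derivative mink (Y p)) (at p within dS)"
proof -
  let ?C = "{y. 0 < mink y y}"
  obtain O' where O': "open O'" "\<Omega> = dS \<inter> O'" using \<Omega> by (auto simp: openin_open)
  have pdS: "p \<in> dS" using p O' by auto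
  define V' where "V' = ?C \<inter> dS_retraction -` (V \<inter> O')"
  have V': "open V'"
    unfolding V'_def using C1_on_imp_continuous_on[OF C1_on_dS_retraction] open_spacelike open_Int[OF V(1) O'(1)]
    by (rule continuous_open_preimage)
  have pV': "p \<in> V'" using p V O' pdS by (simp add: V'_def dS_retraction_eq mink_dS)
  have retr_V': "dS_retraction y \<in> V \<inter> \<Omega>" "0 < mink y y" if "y \<in> V'" for y
    using that O' dS_retraction_in_dS by (auto simp: V'_def)
  define g where "g y = mink (H (dS_retraction y)) y" for y
  have HR: "C1_on (H \<circ> dS_retraction) V'"
    by (rule C1_on_compose[OF H C1_on_subset[OF C1_on_dS_retraction]]) (use retr_V' in auto)
  have dg: "(g has_derivative mink (H (dS_retraction y))) (at y)" if y: "y \<in> V'" for y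
  proof -
    let ?H' = "frechet_derivative H (at (dS_retraction y))" and ?R' = "frechet_derivative dS_retraction (at y)"
    have "(H \<circ> dS_retraction has_derivative ?H' \<circ> ?R') (at y)"
      using retr_V'[OF y] by (intro diff_chain_at C1_on_has_derivative[OF C1_on_dS_retraction]
          C1_on_has_derivative[OF H]) auto
    from mink.FDERIV[OF this has_derivative_ident]
    have "(g has_derivative (\<lambda>v. mink (H (dS_retraction y)) v + mink (?H' (?R' v)) y)) (at y)"
      by (simp add: g_def[abs_def])
    moreover have "mink (?H' v) y = 0" for v
    proof -
      have "mink (dS_retraction y) (?H' v) = 0" by (rule normal[OF retr_V'(1)[OF y]])
      then show ?thesis using retr_V'(2)[OF y] by (simp add: dS_retraction_def mink.scaleR_left mink_commute)
    qed
    ultimately show ?thesis by simp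
  qed
  have "C2_on g V'"
    unfolding C2_on_def
  proof (intro exI conjI ballI)
    show "C1_on (\<lambda>y. Blinfun (mink ((H \<circ> dS_retraction) y))) V'"
      by (rule C1_on_bounded_linear[OF bounded_linear_Blinfun_mink HR])
    show "(g has_derivative blinfun_apply (Blinfun (mink ((H \<circ> dS_retraction) y)))) (at y)" if "y \<in> V'" for y
      using dg[OF that] by (simp add: bounded_linear_Blinfun_apply mink.bounded_linear_right)
  qed
  moreover have g: "y \<in> \<Omega> \<and> g y = support_fun Y y" if "y \<in> V' \<inter> dS" for y
    using that retr_V'[of y] eq[of y] by (auto simp: g_def support_fun_def dS_retraction_eq)
  ultimately show "\<exists>V' g. open V' \<and> p \<in> V' \<and> C2_on g V' \<and> (\<forall>y\<in>V' \<inter> dS. y \<in> \<Omega> \<and> g y = support_fun Y y)"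
    using V' pV' by blast
  have "(g has_derivative mink (Y p)) (at p within dS)"
    using dg[OF pV'] eq[of p] p V(2) by (simp add: dS_retraction_eq[OF pdS] has_derivative_at_withinI)
  then show "(support_fun Y has_derivative mink (Y p)) (at p within dS)"
    by (rule has_derivative_within_dS_transform[OF \<Omega> p V' pV', rotated]) (use g O' in auto)
qed


section \<open>Support functions give minimal surfaces\<close>

lemma dS_atlasD:
  assumes "(W, x) \<in> dS_atlas"
  shows "open W" "x ` W \<subseteq> dS" "C1_on x W" "\<And>w. w \<in> W \<Longrightarrow> tangent_frame (x w) (frechet_derivative x (at w))"
proof -
  show W: "open W" and C1: "C1_on x W" and sub: "x ` W \<subseteq> dS"
    using assms openin_imp_subset[of _ dS "x ` W"] unfolding dS_atlas_def by auto
  show "tangent_frame (x w) (frechet_derivative x (at w))" if w: "w \<in> W" for w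
  proof (rule tangent_frameI)
    have d: "(x has_derivative frechet_derivative x (at w)) (at w)"
      by (rule C1_on_has_derivative[OF C1 w])
    then show "linear (frechet_derivative x (at w))" by (rule has_derivative_linear)
    show "inj (frechet_derivative x (at w))" using assms w by (auto simp: dS_atlas_def)
    show "range (frechet_derivative x (at w)) \<subseteq> tangent (x w)"
      using derivative_into_dS_tangent[OF W w sub d] by auto
  qed (use sub w in auto)
qed

lemma tangent_frame_matrix_mult:
  assumes p: "p \<in> dS" and L: "tangent_frame p L" and F: "\<And>v. F v = L (M *v v)"
  shows "tangent_frame p F \<longleftrightarrow> det M \<noteq> 0" "inj F \<longleftrightarrow> det M \<noteq> 0"
proof -
  have lin: "linear L" and inj: "inj L" and ran: "range L = tangent p"
    using L by (auto simp: tangent_frame_def)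
  have F_eq: "F = L \<circ> (*v) M" using F by auto
  have linF: "linear F"
    unfolding F_eq by (rule linear_compose[OF matrix_vector_mul_linear lin])
  have "inj F \<longleftrightarrow> inj ((*v) M)"
    unfolding F_eq using inj by (metis inj_compose inj_on_imageI2)
  also have "\<dots> \<longleftrightarrow> det M \<noteq> 0"
    by (metis invertible_det_nz invertible_left_inverse matrix_left_invertible_injective)
  finally show i: "inj F \<longleftrightarrow> det M \<noteq> 0" .
  have "range F \<subseteq> tangent p" using ran F by auto
  with linF i show "tangent_frame p F \<longleftrightarrow> det M \<noteq> 0"
    using tangent_frameI[OF p linF] by (auto simp: tangent_frame_def)
qed

text \<open>In a parametrization \<open>x\<close> of \<open>dS\<close>, the point \<open>x w\<close> itself plays the part of the normal, so the
  differential of \<open>x\<close> is the frame to which the formula for the mean curvature applies.\<close>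

lemma X_map_in_chart:
  assumes \<Omega>: "openin (top_of_set dS) \<Omega>" and u: "C2_subset u \<Omega>"
    and box: "\<And>p. p \<in> \<Omega> \<Longrightarrow> box_dS u p + 2 * u p = 0"
    and x: "(W, x) \<in> dS_atlas" and w: "w \<in> W" "x w \<in> reg_set \<Omega> u"
  shows "tangent_frame (x w) (frechet_derivative (X_map u \<circ> x) (at w))"
    and "(X_map u \<circ> x has_derivative frechet_derivative (X_map u \<circ> x) (at w)) (at w)"
    and "mean_curvature (X_map u \<circ> x) x w = 0"
proof -
  have p: "x w \<in> \<Omega>" and reg: "tangent_det (x w) (\<lambda>Y. hess u (x w) Y + u (x w) *\<^sub>R Y) \<noteq> 0"
    using w(2) by (auto simp: reg_set_def)
  have pdS: "x w \<in> dS" using dS_atlasD(2)[OF x] w by auto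
  let ?L = "frechet_derivative x (at w)"
  have L: "tangent_frame (x w) ?L" by (rule dS_atlasD(4)[OF x w(1)])
  have dx: "(x has_derivative ?L) (at w)" by (rule C1_on_has_derivative[OF dS_atlasD(3)[OF x] w(1)])
  obtain S where S: "(X_map u has_derivative S) (at (x w) within dS)"
    by (rule C1_subset_differentiable_within_dS[OF \<Omega> C2_subset_X_map(1)[OF \<Omega> u] p])
  obtain M where M: "\<And>v. S (?L v) = ?L (M *v v)"
    "tangent_det (x w) (\<lambda>Y. hess u (x w) Y + u (x w) *\<^sub>R Y) = det M" "box_dS u (x w) + 2 * u (x w) = trace M"
    by (rule X_map_in_frame[OF \<Omega> u p S L]) blast
  have dX: "(X_map u \<circ> x has_derivative S \<circ> ?L) (at w)"
    by (rule has_derivative_within_dS_compose[OF dS_atlasD(1)[OF x] w(1) dS_atlasD(2)[OF x] dx S])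
  have F: "frechet_derivative (X_map u \<circ> x) (at w) = S \<circ> ?L"
    by (rule frechet_derivative_at[OF dX, symmetric])
  have SL: "(S \<circ> ?L) v = ?L (M *v v)" for v using M(1) by simp
  show "(X_map u \<circ> x has_derivative frechet_derivative (X_map u \<circ> x) (at w)) (at w)"
    using dX F by simp
  have det: "det M \<noteq> 0" using reg M(2) by simp
  then show "tangent_frame (x w) (frechet_derivative (X_map u \<circ> x) (at w))"
    unfolding F by (rule iffD2[OF tangent_frame_matrix_mult(1)[OF pdS L SL]])
  have "trace M = 0" using box[OF p] M(3) by simp
  then show "mean_curvature (X_map u \<circ> x) x w = 0"
    using mean_curvature_eq[OF pdS L SL det dX dx] by simp
qed

lemma C1_map_dS_atlas:
  assumes \<Omega>: "openin (top_of_set dS) \<Omega>" and F: "C1_subset F \<Omega>"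
  shows "C1_map dS_atlas \<Omega> F"
  unfolding C1_map_def
proof clarify
  fix W and x :: "real^2 \<Rightarrow> real^3"
  assume x: "(W, x) \<in> dS_atlas"
  obtain O' where O': "open O'" "\<Omega> = dS \<inter> O'" using \<Omega> by (auto simp: openin_open)
  show "C1_on (F \<circ> x) (W \<inter> x -` \<Omega>)"
  proof (rule C1_on_localI)
    fix w assume w: "w \<in> W \<inter> x -` \<Omega>"
    then have p: "x w \<in> \<Omega>" by simp
    obtain V h where V: "open V" "x w \<in> V" "C1_on h V" "\<forall>y\<in>V \<inter> \<Omega>. h y = F y"
      using bspec[OF F[unfolded C1_subset_def] p] by (elim exE conjE)
    define B where "B = W \<inter> x -` (V \<inter> O')"
    have B: "open B"
      unfolding B_def using C1_on_imp_continuous_on[OF dS_atlasD(3)[OF x]] dS_atlasD(1)[OF x] open_Int[OF V(1) O'(1)]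
      by (rule continuous_open_preimage)
    have "C1_on (h \<circ> x) B"
      by (rule C1_on_compose[OF V(3) C1_on_subset[OF dS_atlasD(3)[OF x]]]) (auto simp: B_def)
    then have "C1_on (F \<circ> x) B"
      by (rule C1_on_cong[OF B, rotated]) (use dS_atlasD(2)[OF x] V(4) O' in \<open>auto simp: B_def\<close>)
    moreover have "w \<in> B" using w V O' by (auto simp: B_def)
    ultimately show "\<exists>V. open V \<and> w \<in> V \<and> C1_on (F \<circ> x) V" using B by blast
  qed
qed

lemma C1_map_subset: "C1_map A U X \<Longrightarrow> U' \<subseteq> U \<Longrightarrow> C1_map A U' X"
  unfolding C1_map_def by (force intro: C1_on_subset)

lemma support_function_minimal_surface:
  assumes \<Omega>: "openin (top_of_set dS) \<Omega>" and u: "C2_subset u \<Omega>"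
    and box: "\<And>p. p \<in> \<Omega> \<Longrightarrow> box_dS u p + 2 * u p = 0"
  shows "timelike_immersion dS_atlas (reg_set \<Omega> u) (X_map u)"
    and "gauss_map dS_atlas (reg_set \<Omega> u) (X_map u) (\<lambda>p. p)"
    and "zero_mean_curvature dS_atlas (reg_set \<Omega> u) (X_map u) (\<lambda>p. p)"
proof -
  note chart = X_map_in_chart[OF \<Omega> u box]
  have reg: "reg_set \<Omega> u \<subseteq> \<Omega>" by (auto simp: reg_set_def)
  have sub: "\<Omega> \<subseteq> dS" using \<Omega> openin_imp_subset by blast
  have "C1_map dS_atlas (reg_set \<Omega> u) (X_map u)"
    by (rule C1_map_subset[OF C1_map_dS_atlas[OF \<Omega> C2_subset_X_map(1)[OF \<Omega> u]] reg])
  moreover have "immersed_at dS_atlas (X_map u) q" if "q \<in> reg_set \<Omega> u" for q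
    using chart(1) that unfolding immersed_at_def tangent_frame_def by blast
  moreover have "lorentzian (first_form (X_map u \<circ> x) w)"
    if "(W, x) \<in> dS_atlas" "w \<in> W" "x w \<in> reg_set \<Omega> u" for W x w
    using chart(1,2)[OF _ that] that reg sub by (auto simp: first_form_eq intro!: lorentzian_gram[of "x w"])
  ultimately show "timelike_immersion dS_atlas (reg_set \<Omega> u) (X_map u)"
    unfolding timelike_immersion_def by blast
  have "C1_map dS_atlas (reg_set \<Omega> u) (\<lambda>p. p)"
    unfolding C1_map_def using dS_atlasD(3) by (auto simp: o_def intro: C1_on_subset)
  moreover have "mink (x w) (frechet_derivative (X_map u \<circ> x) (at w) v) = 0"
    if "(W, x) \<in> dS_atlas" "w \<in> W" "x w \<in> reg_set \<Omega> u" for W x w v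
    using chart(1)[OF _ that] by (auto simp: tangent_frame_def tangent_def)
  ultimately show "gauss_map dS_atlas (reg_set \<Omega> u) (X_map u) (\<lambda>p. p)"
    unfolding gauss_map_def using reg sub by auto
  show "zero_mean_curvature dS_atlas (reg_set \<Omega> u) (X_map u) (\<lambda>p. p)"
    unfolding zero_mean_curvature_def using chart(3) by (auto simp: o_def)
qed


section \<open>Minimal surfaces are given by support functions\<close>

lemma C1_surface_chart:
  assumes "C1_surface T A" "(W, x) \<in> A"
  shows "open W" "openin T (x ` W)" "homeomorphic_map (top_of_set W) (subtopology T (x ` W)) x"
proof -
  have "\<forall>(W, x)\<in>A. open W \<and> openin T (x ` W) \<and>
      homeomorphic_map (top_of_set W) (subtopology T (x ` W)) x"
    using assms(1) unfolding C1_surface_def by (elim conjE)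
  from bspec[OF this assms(2)]
  show "open W" "openin T (x ` W)" "homeomorphic_map (top_of_set W) (subtopology T (x ` W)) x"
    by simp_all
qed

text \<open>The map \<open>g\<close> extends the inverse Gauss map in the coordinates of the chart to an open set of the
  ambient space. Shrinking \<open>V\<close> makes it take values in the domain of the chart everywhere, not only
  on \<open>dS\<close>, so that it can be composed with the surface.\<close>

lemma inverse_gauss_map_in_chart:
  assumes surf: "C1_surface T A" and U: "diffeo_into_dS T A U N"
    and x: "(W, x) \<in> A" and w: "w \<in> W" "x w \<in> U"
  obtains V g where "openin (top_of_set dS) (N ` (U \<inter> x ` W))" "open V" "N (x w) \<in> V" "C1_on g V"
    "g ` V \<subseteq> W" "\<And>y. y \<in> V \<inter> N ` (U \<inter> x ` W) \<Longrightarrow> x (g y) = inv_into U N y"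
proof -
  have W: "open W" "openin T (x ` W)" "homeomorphic_map (top_of_set W) (subtopology T (x ` W)) x"
    by (rule C1_surface_chart[OF surf x])+
  have N: "openin T U" "openin (top_of_set dS) (N ` U)"
    "homeomorphic_map (subtopology T U) (top_of_set (N ` U)) N"
    "C1_subset (inv_into W x \<circ> inv_into U N) (N ` (U \<inter> x ` W))"
    using U x unfolding diffeo_into_dS_def by blast+
  have inj: "inj_on N U"
    using homeomorphic_imp_injective_map[OF N(3)] openin_subset[OF N(1)] by (simp add: Int_absorb1)
  have "openin (subtopology T U) (U \<inter> x ` W)"
    using W(2) by (simp add: openin_subtopology_Int2)
  then have "openin (top_of_set (N ` U)) (N ` (U \<inter> x ` W))"
    using homeomorphic_imp_open_map[OF N(3)] by (simp add: open_map_def)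
  then have op: "openin (top_of_set dS) (N ` (U \<inter> x ` W))"
    using N(2) by (rule openin_trans)
  have p: "N (x w) \<in> N ` (U \<inter> x ` W)" using w by blast
  obtain V g where V: "open V" "N (x w) \<in> V" "C1_on g V"
    "\<forall>y\<in>V \<inter> N ` (U \<inter> x ` W). g y = (inv_into W x \<circ> inv_into U N) y"
    using bspec[OF N(4)[unfolded C1_subset_def] p] by (elim exE conjE)
  have inW: "g y \<in> W \<and> x (g y) = inv_into U N y" if "y \<in> V \<inter> N ` (U \<inter> x ` W)" for y
  proof -
    have "inv_into U N y \<in> x ` W" using that inj by auto
    then show ?thesis using V(4) that by (simp add: inv_into_into f_inv_into_f)
  qed
  show ?thesis
  proof (rule that[of "V \<inter> g -` W" g])
    show "open (V \<inter> g -` W)"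
      using C1_on_imp_continuous_on[OF V(3)] V(1) W(1) by (rule continuous_open_preimage)
    show "N (x w) \<in> V \<inter> g -` W" using inW p V(2) by auto
    show "C1_on g (V \<inter> g -` W)" using V(3) by (rule C1_on_subset) auto
  qed (use op inW in auto)
qed

lemma chart_preimage_open:
  assumes surf: "C1_surface T A" and U: "openin T U" and x: "(W, x) \<in> A"
  shows "open (W \<inter> x -` U)"
proof -
  have W: "open W" "openin T (x ` W)" "homeomorphic_map (top_of_set W) (subtopology T (x ` W)) x"
    by (rule C1_surface_chart[OF surf x])+
  have "openin (subtopology T (x ` W)) (x ` W \<inter> U)"
    using U by (simp add: openin_subtopology_Int2)
  then have "openin (top_of_set W) {w \<in> topspace (top_of_set W). x w \<in> x ` W \<inter> U}"
    using homeomorphic_imp_continuous_map[OF W(3)] openin_continuous_map_preimage by blast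
  moreover have "{w \<in> topspace (top_of_set W). x w \<in> x ` W \<inter> U} = W \<inter> x -` U" by auto
  ultimately show ?thesis using W(1) by (metis openin_open_trans)
qed

text \<open>The surface, reparametrized by its normal, is \<open>Y\<close>. The support function lemma makes \<open>u\<close> a C2
  function whose derivative within \<open>dS\<close> is represented by \<open>Y p\<close>, so that the tangential part of
  \<open>Y p\<close> is \<open>grad u p\<close> and the normal part is \<open>u p\<close>. Then \<open>Y\<close> is \<open>X_map u\<close>, and minimality is the
  vanishing of the trace that expresses the equation for \<open>u\<close>.\<close>

lemma minimal_surface_support_function:
  assumes surf: "C1_surface T A" and X: "C1_map A (topspace T) X"
    and gauss: "gauss_map A (branch_free T A X) X N"
    and mean: "zero_mean_curvature A (branch_free T A X) X N"
    and UB: "U \<subseteq> branch_free T A X" and U: "diffeo_into_dS T A U N"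
  defines "Y \<equiv> X \<circ> inv_into U N"
  defines "u \<equiv> support_fun Y"
  shows "C2_subset u (N ` U)"
    and "\<And>p. p \<in> N ` U \<Longrightarrow> Y p = u p *\<^sub>R p + grad u p"
    and "\<And>p. p \<in> N ` U \<Longrightarrow> box_dS u p + 2 * u p = 0"
proof -
  have NU: "openin T U" "openin (top_of_set dS) (N ` U)" "C1_map A U N"
    using U unfolding diffeo_into_dS_def by blast+
  then have NdS: "N ` U \<subseteq> dS" using openin_imp_subset by blast
  have inj: "inj_on N U"
    using homeomorphic_imp_injective_map[of "subtopology T U" "top_of_set (N ` U)" N] openin_subset[OF NU(1)]
      U[unfolded diffeo_into_dS_def] by (simp add: Int_absorb1)
  have chart: "\<exists>W x w. (W, x) \<in> A \<and> w \<in> W \<and> x w \<in> U \<and> p = N (x w)" if "p \<in> N ` U" for p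
  proof -
    from that obtain r where r: "r \<in> U" "p = N r" by blast
    moreover have "topspace T = (\<Union>(W, x)\<in>A. x ` W)" using surf unfolding C1_surface_def by (elim conjE)
    ultimately have "r \<in> (\<Union>(W, x)\<in>A. x ` W)"
      using openin_subset[OF NU(1)] by blast
    then show ?thesis using r by fastforce
  qed
  have loc: "(\<exists>V' g. open V' \<and> p \<in> V' \<and> C2_on g V' \<and> (\<forall>y\<in>V' \<inter> N ` U. g y = u y)) \<and>
      (u has_derivative mink (Y p)) (at p within dS)" if p: "p \<in> N ` U" for p
  proof -
    obtain W x w where x: "(W, x) \<in> A" and w: "w \<in> W" "x w \<in> U" and pw: "p = N (x w)"
      using chart[OF p] by blast
    let ?\<Omega> = "N ` (U \<inter> x ` W)"
    obtain V g where V: "openin (top_of_set dS) ?\<Omega>" "open V" "p \<in> V" "C1_on g V" "g ` V \<subseteq> W"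
      "\<And>y. y \<in> V \<inter> ?\<Omega> \<Longrightarrow> x (g y) = inv_into U N y"
      by (rule inverse_gauss_map_in_chart[OF surf U x w, folded pw]) blast
    have CX: "C1_on (X \<circ> x) W"
    proof -
      have "x ` W \<subseteq> topspace T" using C1_surface_chart(2)[OF surf x] by (rule openin_subset)
      then have "W \<inter> x -` topspace T = W" by auto
      then show ?thesis using X x unfolding C1_map_def by fastforce
    qed
    define H where "H = X \<circ> x \<circ> g"
    have H: "C1_on H V" unfolding H_def by (rule C1_on_compose[OF CX V(4,5)])
    have HY: "H y = Y y" if "y \<in> V \<inter> ?\<Omega>" for y
      using V(6)[OF that] by (simp add: H_def Y_def)
    \<comment> \<open>The surface is orthogonal to its normal, which is \<open>y\<close> in the inverse Gauss parametrization.\<close>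
    have normal: "mink y (frechet_derivative H (at y) v) = 0" if y: "y \<in> V \<inter> ?\<Omega>" for y v
    proof -
      have gW: "g y \<in> W" using y V(5) by auto
      have yU: "y \<in> N ` U" using y by auto
      have xg: "x (g y) \<in> U" "N (x (g y)) = y"
        using V(6)[OF y] yU by (simp_all add: inv_into_into f_inv_into_f)
      have "(H has_derivative frechet_derivative (X \<circ> x) (at (g y)) \<circ> frechet_derivative g (at y)) (at y)"
        unfolding H_def
        by (intro diff_chain_at C1_on_has_derivative[OF V(4)] C1_on_has_derivative[OF CX] gW) (use y in auto)
      from frechet_derivative_at[OF this]
      have "frechet_derivative H (at y) v = frechet_derivative (X \<circ> x) (at (g y)) (frechet_derivative g (at y) v)"
        by (metis comp_apply)
      moreover have gB: "g y \<in> W \<inter> x -` branch_free T A X" using gW xg(1) UB by auto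
      have G: "\<forall>(W, x)\<in>A. \<forall>w\<in>W \<inter> x -` branch_free T A X.
          \<forall>v. mink (N (x w)) (frechet_derivative (X \<circ> x) (at w) v) = 0"
        using gauss unfolding gauss_map_def by (elim conjE)
      have "mink (N (x (g y))) (frechet_derivative (X \<circ> x) (at (g y)) z) = 0" for z
        using bspec[OF bspec[OF G x, unfolded prod.case] gB] by blast
      ultimately show ?thesis using xg(2) by simp
    qed
    have p': "p \<in> ?\<Omega>" using pw w by blast
    from support_fun_local[OF V(1) p' V(2,3) H HY normal, folded u_def]
    show ?thesis using NdS by blast
  qed
  show C2: "C2_subset u (N ` U)" unfolding C2_subset_def using loc by simp
  show XY: "Y p = u p *\<^sub>R p + grad u p" if p: "p \<in> N ` U" for p
  proof -
    have "grad u p = tangent_proj p (Y p)" using grad_eq(1) loc[OF p] p NdS by blast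
    then show ?thesis by (simp add: tangent_proj_def u_def support_fun_def mink_commute)
  qed
  show "box_dS u p + 2 * u p = 0" if p: "p \<in> N ` U" for p
  proof -
    obtain W x w where x: "(W, x) \<in> A" and w: "w \<in> W" "x w \<in> U" and pw: "p = N (x w)"
      using chart[OF p] by blast
    let ?\<Omega> = "N ` (U \<inter> x ` W)"
    obtain V g where V: "open V" "p \<in> V" "C1_on g V" "g ` V \<subseteq> W"
      "\<And>y. y \<in> V \<inter> ?\<Omega> \<Longrightarrow> x (g y) = inv_into U N y"
      by (rule inverse_gauss_map_in_chart[OF surf U x w, folded pw]) blast
    have injx: "inj_on x W"
      using homeomorphic_imp_injective_map[OF C1_surface_chart(3)[OF surf x]] by simp
    let ?B = "W \<inter> x -` U"
    have B: "open ?B" by (rule chart_preimage_open[OF surf NU(1) x])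
    have wB: "w \<in> ?B" using w by simp
    have pdS: "p \<in> dS" using p NdS by auto
    have CN: "C1_on (N \<circ> x) ?B" using NU(3) x unfolding C1_map_def by blast
    define L where "L = frechet_derivative (N \<circ> x) (at w)"
    have dL: "(N \<circ> x has_derivative L) (at w)"
      unfolding L_def by (rule C1_on_has_derivative[OF CN wB])
    have NB: "(N \<circ> x) ` ?B \<subseteq> dS" using NdS by auto
    \<comment> \<open>Near \<open>w\<close> the map \<open>g\<close> is a left inverse of \<open>N \<circ> x\<close>, so its derivative is a left inverse of \<open>L\<close>.\<close>
    have "inj L"
    proof -
      have op: "open (?B \<inter> (N \<circ> x) -` V)"
        using C1_on_imp_continuous_on[OF CN] B V(1) by (rule continuous_open_preimage)
      have gN: "(g \<circ> (N \<circ> x)) w' = w'" if "w' \<in> ?B \<inter> (N \<circ> x) -` V" for w'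
      proof -
        have "x (g (N (x w'))) = x w'"
          using V(5)[of "N (x w')"] that inj by auto
        moreover have "g (N (x w')) \<in> W" using V(4) that by auto
        ultimately show ?thesis using injx that by (auto dest: inj_onD)
      qed
      have dg: "(g \<circ> (N \<circ> x) has_derivative frechet_derivative g (at p) \<circ> L) (at w)"
        by (rule diff_chain_at[OF dL]) (use C1_on_has_derivative[OF V(3,2)] pw in simp)
      have "w \<in> ?B \<inter> (N \<circ> x) -` V" using w V(2) pw by auto
      from has_derivative_transform_within_open[OF dg op this gN]
      have "((\<lambda>w. w) has_derivative frechet_derivative g (at p) \<circ> L) (at w)" .
      then have "frechet_derivative g (at p) \<circ> L = (\<lambda>v. v)"
        using has_derivative_unique has_derivative_ident by blast
      then show ?thesis by (metis inj_on_id2 inj_on_imageI2)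
    qed
    moreover have "range L \<subseteq> tangent p"
      using derivative_into_dS_tangent[OF B wB NB dL] pw by auto
    ultimately have L: "tangent_frame p L"
      by (intro tangent_frameI[OF pdS has_derivative_linear[OF dL]])
    obtain S where S: "(X_map u has_derivative S) (at p within dS)"
      by (rule C1_subset_differentiable_within_dS[OF NU(2) C2_subset_X_map(1)[OF NU(2) C2] p])
    obtain M where M: "\<And>v. S (L v) = L (M *v v)"
      "tangent_det p (\<lambda>Y. hess u p Y + u p *\<^sub>R Y) = det M" "box_dS u p + 2 * u p = trace M"
      by (rule X_map_in_frame[OF NU(2) C2 p S L]) blast
    have SL: "(S \<circ> L) v = L (M *v v)" for v using M(1) by simp
    have "(X_map u \<circ> (N \<circ> x) has_derivative S \<circ> L) (at w)"
      by (rule has_derivative_within_dS_compose[OF B wB NB dL]) (use S pw in simp)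
    \<comment> \<open>By the representation just proved, the surface is \<open>X_map u\<close> composed with its normal.\<close>
    then have dX: "(X \<circ> x has_derivative S \<circ> L) (at w)"
    proof (rule has_derivative_transform_within_open[OF _ B wB])
      show "(X_map u \<circ> (N \<circ> x)) w' = (X \<circ> x) w'" if "w' \<in> ?B" for w'
        using that XY[of "N (x w')"] inj by (simp add: X_map_def Y_def)
    qed
    have R: "x w \<in> branch_free T A X" using w UB by auto
    then have "inj (frechet_derivative (X \<circ> x) (at w))"
      using x w(1) unfolding branch_free_def immersed_at_def by blast
    then have "inj (S \<circ> L)" using frechet_derivative_at[OF dX] by simp
    then have det: "det M \<noteq> 0" by (rule iffD1[OF tangent_frame_matrix_mult(2)[OF pdS L SL]])
    have "mean_curvature (X \<circ> x) (N \<circ> x) w = 0"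
      using mean x w(1) R unfolding zero_mean_curvature_def by blast
    then have "trace M = 0"
      using mean_curvature_eq[OF pdS L SL det dX dL] det by simp
    then show ?thesis using M(3) by simp
  qed
qed

theorem theorem4p1:
  shows "(\<forall>(\<Omega>::(real^3) set) (u::real^3 \<Rightarrow> real).
            openin (top_of_set dS) \<Omega> \<and> connected \<Omega> \<and> C2_subset u \<Omega> \<and>
            (\<forall>p\<in>\<Omega>. box_dS u p + 2 * u p = 0)
            \<longrightarrow> timelike_immersion dS_atlas (reg_set \<Omega> u) (X_map u) \<and>
                gauss_map dS_atlas (reg_set \<Omega> u) (X_map u) (\<lambda>p. p) \<and>
                zero_mean_curvature dS_atlas (reg_set \<Omega> u) (X_map u) (\<lambda>p. p))
       \<and> (\<forall>(T::'m topology) (A::'m atlas) (X::'m \<Rightarrow> real^3) (N::'m \<Rightarrow> real^3).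
            C1_surface T A \<and> C1_map A (topspace T) X \<and>
            timelike_immersion A (branch_free T A X) X \<and>
            gauss_map A (branch_free T A X) X N \<and>
            zero_mean_curvature A (branch_free T A X) X N \<and>
            local_diffeo_into_dS T A (branch_free T A X) N
            \<longrightarrow> (\<forall>q\<in>branch_free T A X. \<exists>U. q \<in> U \<and> U \<subseteq> branch_free T A X \<and>
                   diffeo_into_dS T A U N \<and>
                   (let Y = X \<circ> inv_into U N; u = support_fun Y in
                      C2_subset u (N ` U) \<and>
                      (\<forall>p\<in>N ` U. Y p = u p *\<^sub>R p + grad u p \<and> box_dS u p + 2 * u p = 0))))"
proof (intro conjI allI impI; elim conjE)
  fix \<Omega> :: "(real^3) set" and u :: "real^3 \<Rightarrow> real"
  assume "openin (top_of_set dS) \<Omega>" "C2_subset u \<Omega>" "\<forall>p\<in>\<Omega>. box_dS u p + 2 * u p = 0"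
  then show "timelike_immersion dS_atlas (reg_set \<Omega> u) (X_map u)"
    "gauss_map dS_atlas (reg_set \<Omega> u) (X_map u) (\<lambda>p. p)"
    "zero_mean_curvature dS_atlas (reg_set \<Omega> u) (X_map u) (\<lambda>p. p)"
    using support_function_minimal_surface by blast+
next
  fix T :: "'m topology" and A :: "'m atlas" and X N :: "'m \<Rightarrow> real^3"
  assume *: "C1_surface T A" "C1_map A (topspace T) X" "gauss_map A (branch_free T A X) X N"
    "zero_mean_curvature A (branch_free T A X) X N"
    and "local_diffeo_into_dS T A (branch_free T A X) N"
  show "\<forall>q\<in>branch_free T A X. \<exists>U. q \<in> U \<and> U \<subseteq> branch_free T A X \<and>
      diffeo_into_dS T A U N \<and>
      (let Y = X \<circ> inv_into U N; u = support_fun Y in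
        C2_subset u (N ` U) \<and>
        (\<forall>p\<in>N ` U. Y p = u p *\<^sub>R p + grad u p \<and> box_dS u p + 2 * u p = 0))"
  proof
    fix q assume "q \<in> branch_free T A X"
    then obtain U where U: "q \<in> U" "U \<subseteq> branch_free T A X" "diffeo_into_dS T A U N"
      using \<open>local_diffeo_into_dS T A (branch_free T A X) N\<close> unfolding local_diffeo_into_dS_def by blast
    from minimal_surface_support_function[OF * U(2,3)] U
    show "\<exists>U. q \<in> U \<and> U \<subseteq> branch_free T A X \<and> diffeo_into_dS T A U N \<and>
      (let Y = X \<circ> inv_into U N; u = support_fun Y in
        C2_subset u (N ` U) \<and>
        (\<forall>p\<in>N ` U. Y p = u p *\<^sub>R p + grad u p \<and> box_dS u p + 2 * u p = 0))"
      unfolding Let_def by (intro exI[of _ U] conjI ballI)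
  qed
qed

end
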